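(* Let $S=\{s_1,s_2,\dots,s_t\}\subset\mathbb{N}$ be a finite set of positive integers with $|S|=t$. Let $p(n)$ denote the number of partitions of $n$ and $p_{-S}(n)$ the number of partitions of $n$ with all parts in $\mathbb{N}\setminus S$. Then, as $n\to\infty$, $$ p_{-S}(n)\sim p(n)\left(\frac{C}{2\sqrt{n}}\right)^t\prod_{s\in S}s = p(n)\prod_{s\in S}\frac{Cs}{2\sqrt{n}}, $$ where $C=\pi\sqrt{2/3}$.
   Context: A partition of $n$ is a non-increasing sequence of positive integers (parts) summing to $n$. $f(n)\sim g(n)$ means $\lim_{n\to\infty} f(n)/g(n)=1$. *)

theory Defs
  imports "HOL-Analysis.Analysis" "HOL-Library.Landau_Symbols"
begin

definition partitions :: "nat \<Rightarrow> nat list set" where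
  "partitions n = {xs. sorted_wrt (\<ge>) xs \<and> (\<forall>x\<in>set xs. 0 < x) \<and> sum_list xs = n}"

definition num_partitions :: "nat \<Rightarrow> nat" where
  "num_partitions n = card (partitions n)"

definition num_partitions_avoiding :: "nat set \<Rightarrow> nat \<Rightarrow> nat" where
  "num_partitions_avoiding S n = card {xs \<in> partitions n. set xs \<inter> S = {}}"

text \<open>Both counts are cardinalities of finite sets, so \<^const>\<open>card\<close> is never the default 0.\<close>

lemma finite_partitions: "finite (partitions n)"
proof (rule finite_subset)
  have "length xs \<le> sum_list xs" if "\<forall>x\<in>set xs. 0 < x" for xs :: "nat list"
    using that by (induction xs) auto
  then show "partitions n \<subseteq> {xs. set xs \<subseteq> {..n} \<and> length xs \<le> n}"
    by (auto simp: partitions_def intro: member_le_sum_list)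
  show "finite {xs. set xs \<subseteq> {..n} \<and> length xs \<le> n}"
    by (rule finite_lists_length_le) simp
qed

definition C :: real where
  "C = pi * sqrt (2 / 3)"

end

theory Submission
  imports Defs "HOL-Complex_Analysis.Complex_Analysis" "HOL-Real_Asymp.Real_Asymp"
begin

text \<open>
  The counts \<open>p\<close> and \<open>p\<^sub>-\<^sub>S\<close> are Cauchy coefficients of \<open>\<Prod>k. 1 / (1 - z ^ k)\<close> and of the
  same product multiplied by \<open>\<Prod>s\<in>S. 1 - z ^ s\<close>.  Both integrals are taken over the circle of radius
  \<open>r = exp (- x)\<close> with \<open>x = C / (2 * sqrt n)\<close>, the approximate saddle point.  The infinite product
  concentrates on angles of order \<open>x powr (3 / 2)\<close>, which is \<open>o(x)\<close>; on that scale the extra factor is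
  \<open>(1 + o(1)) * (\<Prod>s\<in>S. 1 - r ^ s)\<close>.  After normalisation both integrals
  therefore tend to the same nonzero Gaussian integral, so only the factor
  \<open>(\<Prod>s\<in>S. 1 - r ^ s) \<sim> (\<Prod>s\<in>S. s * x)\<close> survives in the quotient, and the asymptotics
  of \<open>p\<close> itself are never needed.  The product is truncated at a large \<open>K\<close> depending on \<open>n\<close>,
  which leaves the coefficient unchanged.
\<close>

subsection \<open>Partition counts as Cauchy integrals\<close>

text \<open>Since the two integrals are only compared with each other, rough information about the
  product suffices: the variance \<open>cum2\<close> lies between two multiples of 1 / x^3, and the
  mean \<open>cum1\<close> equals n up to O(1 / x). At angles of order x^(3/2) a mean off by O(1 /
  x) turns the phase by O(sqrt x), and the cubic Taylor error, \<theta>^3 / x^4, is O(sqrt x) as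
  well, so both vanish in the limit. The leading term of the mean is pi^2 / (6 x^2); setting it
  equal to n gives x = C / (2 sqrt n) and explains C. The obstacle is that the factors for S, once
  normalised, can grow like powers of 1 / x away from the saddle point. One decay estimate, valid
  for all |\<theta>| <= pi, yields exp (- c / x) at angles beyond x, and this absorbs every such
  power. A finite K turns logarithms and derivatives of the product into finite sums; as K is picked
  after x, the constants in the upper bounds must not depend on K.\<close>

definition count_parts_in :: "nat set \<Rightarrow> nat \<Rightarrow> nat" where
  "count_parts_in A n = card {M. set_mset M \<subseteq> A \<and> \<Sum>\<^sub># M = n}"

lemma bij_betw_mset_partitions:
  assumes "0 \<notin> A"
  shows "bij_betw mset {xs \<in> partitions n. set xs \<subseteq> A} {M. set_mset M \<subseteq> A \<and> \<Sum>\<^sub># M = n}"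
proof (rule bij_betwI')
  fix xs ys assume xs: "xs \<in> {xs \<in> partitions n. set xs \<subseteq> A}" and ys: "ys \<in> {xs \<in> partitions n. set xs \<subseteq> A}"
  show "(mset xs = mset ys) = (xs = ys)"
  proof
    assume "mset xs = mset ys"
    then have m: "mset (rev xs) = mset (rev ys)" by simp
    have "sorted (rev xs)" "sorted (rev ys)"
      using xs ys by (auto simp: partitions_def sorted_wrt_rev)
    with m have "rev xs = rev ys" by (metis properties_for_sort)
    then show "xs = ys" by simp
  qed auto
next
  fix xs assume "xs \<in> {xs \<in> partitions n. set xs \<subseteq> A}"
  then show "mset xs \<in> {M. set_mset M \<subseteq> A \<and> \<Sum>\<^sub># M = n}"
    by (auto simp: partitions_def sum_mset_sum_list)
next
  fix M assume M: "M \<in> {M. set_mset M \<subseteq> A \<and> \<Sum>\<^sub># M = n}"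
  define xs where "xs = rev (sorted_list_of_multiset M)"
  have "mset xs = M" by (simp add: xs_def)
  moreover have "sorted_wrt (\<ge>) xs"
    by (simp add: xs_def sorted_wrt_rev)
  moreover have "set xs = set_mset M" by (simp add: xs_def)
  moreover have "sum_list xs = n" using M \<open>mset xs = M\<close> by (auto simp flip: sum_mset_sum_list)
  moreover have "\<forall>x\<in>set xs. 0 < x" using M assms \<open>set xs = set_mset M\<close> by (metis (no_types, lifting) mem_Collect_eq neq0_conv subsetD)
  ultimately show "\<exists>xs\<in>{xs \<in> partitions n. set xs \<subseteq> A}. M = mset xs"
    using M by (intro bexI[of _ xs]) (auto simp: partitions_def)
qed

lemma finite_mset_sum:
  fixes A :: "nat set"
  assumes "0 \<notin> A"
  shows "finite {M. set_mset M \<subseteq> A \<and> \<Sum>\<^sub># M = n}"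
  using bij_betw_finite[OF bij_betw_mset_partitions[OF assms, of n]] finite_partitions[of n] by auto

lemma num_partitions_avoiding_eq_count:
  assumes "n \<le> K"
  shows "num_partitions_avoiding S n = count_parts_in ({1..K} - S) n"
proof -
  have "{xs \<in> partitions n. set xs \<inter> S = {}} = {xs \<in> partitions n. set xs \<subseteq> {1..K} - S}"
    using assms by (fastforce simp: partitions_def dest: member_le_sum_list)
  then show ?thesis
    unfolding num_partitions_avoiding_def count_parts_in_def
    using bij_betw_same_card[OF bij_betw_mset_partitions[of "{1..K} - S" n]] by simp
qed

text \<open>Split on whether \<open>a\<close> occurs. Deleting one copy leaves a multiset that may
  still contain \<open>a\<close>, hence \<open>insert a A\<close> on the right. Read on
  coefficients, this says that multiplying by 1 - X^a removes \<open>a\<close> from the allowed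
  parts. Multisets make the deletion a bijection without any reordering.\<close>

lemma count_parts_in_insert:
  assumes "0 \<notin> A" "a > 0" "a \<notin> A"
  shows "count_parts_in (insert a A) n = count_parts_in A n + (if a \<le> n then count_parts_in (insert a A) (n - a) else 0)"
proof -
  let ?P = "\<lambda>A n. {M. set_mset M \<subseteq> A \<and> \<Sum>\<^sub># M = n}"
  let ?Q = "{M. set_mset M \<subseteq> insert a A \<and> \<Sum>\<^sub># M = n \<and> a \<in># M}"
  have split: "?P (insert a A) n = ?P A n \<union> ?Q" using assms by auto
  have "count_parts_in (insert a A) n = card (?P A n) + card ?Q"
    unfolding count_parts_in_def split
    using finite_mset_sum[of "insert a A" n] finite_mset_sum[of A n] assms
    by (intro card_Un_disjoint) (auto elim!: finite_subset[rotated])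
  moreover have "card ?Q = (if a \<le> n then count_parts_in (insert a A) (n - a) else 0)"
  proof (cases "a \<le> n")
    case True
    have "bij_betw (add_mset a) (?P (insert a A) (n - a)) ?Q"
    proof (rule bij_betwI')
      fix M assume "M \<in> ?Q"
      then show "\<exists>N\<in>?P (insert a A) (n - a). M = add_mset a N"
        by (intro bexI[of _ "M - {#a#}"]) (auto dest: in_diffD simp: sum_mset_diff)
    qed (use True in auto)
    then show ?thesis using True by (simp add: count_parts_in_def bij_betw_same_card)
  next
    case False
    have "?Q = {}" using False by (auto dest!: multi_member_split)
    then show ?thesis using False by (simp only: card.empty if_False)
  qed
  ultimately show ?thesis by (simp add: count_parts_in_def)
qed

lemma fps_count_parts_in:
  assumes "finite A" "0 \<notin> A"
  shows "Abs_fps (\<lambda>n. of_nat (count_parts_in A n)) * (\<Prod>a\<in>A. 1 - fps_X ^ a) = (1 :: complex fps)"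
  using assms
proof (induction A rule: finite_induct)
  case empty
  have "{M. M = {#} \<and> \<Sum>\<^sub># M = n} = (if n = 0 then {{#}} else {})" for n :: nat by auto
  then have "count_parts_in {} n = (if n = 0 then 1 else 0)" for n
    by (simp add: count_parts_in_def)
  then show ?case by (simp add: fps_eq_iff)
next
  case (insert a A)
  let ?F = "\<lambda>A. Abs_fps (\<lambda>n. of_nat (count_parts_in A n)) :: complex fps"
  have "?F (insert a A) * (1 - fps_X ^ a) = ?F A"
    using insert by (intro fps_ext)
      (auto simp: right_diff_distrib fps_X_power_mult_right_nth count_parts_in_insert)
  then show ?case using insert by (simp flip: mult.assoc)
qed

lemma count_parts_in_eq_deriv:
  assumes "finite A" "0 \<notin> A"
  shows "of_nat (count_parts_in A n) = (deriv ^^ n) (\<lambda>z. 1 / (\<Prod>a\<in>A. 1 - z ^ a)) 0 / (fact n :: complex)"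
proof -
  let ?P = "\<Prod>a\<in>A. (1 - fps_X ^ a :: complex fps)"
  \<comment> \<open>Comparing constant terms in the product identity: this one times another number
    is 1.\<close>
  have nz: "fps_nth ?P 0 \<noteq> 0"
    using arg_cong[OF fps_count_parts_in[OF assms], of "\<lambda>F. fps_nth F 0"] by auto
  have "(\<lambda>z. \<Prod>a\<in>A. 1 - z ^ a) has_fps_expansion ?P"
    by (intro fps_expansion_intros)
  from has_fps_expansion_inverse[OF this nz]
  have "(\<lambda>z. 1 / (\<Prod>a\<in>A. 1 - z ^ a)) has_fps_expansion inverse ?P"
    by (simp add: divide_simps)
  moreover have "inverse ?P = Abs_fps (\<lambda>n. of_nat (count_parts_in A n))"
    using fps_count_parts_in[OF assms] by (metis fps_inverse_unique mult.commute)
  ultimately show ?thesis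
    by (metis (no_types, lifting) fps_nth_Abs_fps fps_nth_fps_expansion)
qed

lemma has_integral_count_parts_in:
  assumes "finite A" "0 \<notin> A" "0 < r" "r < 1"
  shows "((\<lambda>t. cis (- real n * t) / (\<Prod>a\<in>A. 1 - (r * cis t) ^ a)) has_integral
            of_real (2 * pi * r ^ n * count_parts_in A n)) {-pi..pi}"
proof -
  \<comment> \<open>The contour is parametrised over {0..2 pi}, but the saddle point should sit in
    the middle of {-pi..pi}. Shifting t by pi replaces \<open>cis t\<close> by its negative, which
    the sign in \<open>(- z) ^ a\<close> undoes in advance. The remaining signs (-1)^n cancel in
    pairs.\<close>
  define f where "f = (\<lambda>z::complex. 1 / (\<Prod>a\<in>A. 1 - (- z) ^ a))"
  have ne: "(\<Prod>a\<in>A. 1 - z ^ a) \<noteq> 0" if "norm z < 1" for z :: complex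
  proof -
    have "z ^ a \<noteq> 1" if "a \<in> A" for a
    proof
      assume "z ^ a = 1"
      then have "norm z ^ a = 1" by (metis norm_one norm_power)
      moreover have "norm z ^ a < 1"
        using \<open>norm z < 1\<close> that assms(2) by (metis norm_ge_zero power_less_one_iff zero_less_iff_neq_zero)
      ultimately show False by simp
    qed
    then show ?thesis using assms(1) by auto
  qed
  have hol: "f holomorphic_on ball 0 1"
    unfolding f_def using ne by (intro holomorphic_intros) auto
  have g: "((\<lambda>u. f u / (u - 0) ^ Suc n) has_contour_integral
      (2 * pi * \<i> / fact n) * (deriv ^^ n) f 0) (circlepath 0 r)"
    using assms hol
    by (intro Cauchy_has_contour_integral_higher_derivative_circlepath)
       (auto intro!: holomorphic_on_imp_continuous_on elim!: holomorphic_on_subset)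
  have "(deriv ^^ n) f 0 = (-1) ^ n * (deriv ^^ n) (\<lambda>z. 1 / (\<Prod>a\<in>A. 1 - z ^ a)) 0"
  proof -
    have "(deriv ^^ n) (\<lambda>w. (\<lambda>z. 1 / (\<Prod>a\<in>A. 1 - z ^ a)) ((-1) * w)) 0
       = (-1) ^ n * (deriv ^^ n) (\<lambda>z. 1 / (\<Prod>a\<in>A. 1 - z ^ a)) ((-1) * (0::complex))"
      using ne by (intro higher_deriv_compose_linear[where S="ball 0 1" and T="ball 0 1"]) (auto intro!: holomorphic_intros)
    then show ?thesis by (simp add: f_def)
  qed
  then have d: "(2 * pi * \<i> / fact n) * (deriv ^^ n) f 0 = 2 * pi * \<i> * (-1) ^ n * count_parts_in A n"
    using count_parts_in_eq_deriv[OF assms(1,2), of n] by simp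
  have "((\<lambda>t. f (r * cis t) / (r * cis t) ^ Suc n * r * \<i> * cis t) has_integral
          2 * pi * \<i> * (-1) ^ n * count_parts_in A n) {0..2 * pi}"
    using g unfolding d circlepath_def
    by (subst (asm) has_contour_integral_part_circlepath_iff) auto
  then have "((\<lambda>t. f (r * cis (t + pi)) / (r * cis (t + pi)) ^ Suc n * r * \<i> * cis (t + pi)) has_integral
          2 * pi * \<i> * (-1) ^ n * count_parts_in A n) {-pi..pi}"
    using has_integral_affinity[of _ _ 0 "2*pi" 1 pi] by (simp add: image_affinity_atLeastAtMost_diff )
  then have "((\<lambda>t. (f (r * cis (t + pi)) / (r * cis (t + pi)) ^ Suc n * r * \<i> * cis (t + pi)) * ((-1)^n * r ^ n / \<i>)) has_integral
          2 * pi * \<i> * (-1) ^ n * count_parts_in A n * ((-1)^n * r ^ n / \<i>)) {-pi..pi}"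
    by (rule has_integral_mult_left)
  also have "2 * pi * \<i> * (-1) ^ n * count_parts_in A n * ((-1)^n * r ^ n / \<i>) = of_real (2 * pi * r ^ n * count_parts_in A n)"
    by (simp flip: power_mult_distrib)
  also have "(\<lambda>t. (f (r * cis (t + pi)) / (r * cis (t + pi)) ^ Suc n * r * \<i> * cis (t + pi)) * ((-1)^n * r ^ n / \<i>))
     = (\<lambda>t. cis (- real n * t) / (\<Prod>a\<in>A. 1 - (r * cis t) ^ a))"
  proof
    fix t
    have c: "cis (t + pi) = - cis t" by (simp add: complex_eq_iff)
    have i: "cis (- real n * t) = inverse (cis t ^ n)" by (simp only: Complex.DeMoivre cis_inverse mult_minus_left)
    define c :: complex where "c = cis t"
    define P where "P = (\<Prod>a\<in>A. 1 - (r * c) ^ a)"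
    have "c \<noteq> 0" by (simp add: c_def)
    have f: "f (r * - c) = 1 / P" by (simp add: f_def P_def)
    have p: "(r * - c) ^ Suc n = - ((-1) ^ n * r ^ n * r * c ^ n * c)"
      by (simp add: power_mult_distrib power_minus[of "r * c"])
    have m: "(-1 :: complex) ^ n * (-1) ^ n = 1" by (simp flip: power_mult_distrib)
    have "1 / P / - ((-1) ^ n * r ^ n * r * c ^ n * c) * r * \<i> * (- c) * ((-1) ^ n * r ^ n / \<i>) = inverse (c ^ n) / P"
      using \<open>c \<noteq> 0\<close> assms(3) by (simp add: divide_simps)
    then show "(f (r * cis (t + pi)) / (r * cis (t + pi)) ^ Suc n * r * \<i> * cis (t + pi)) * ((-1)^n * r ^ n / \<i>) =
       cis (- real n * t) / (\<Prod>a\<in>A. 1 - (r * cis t) ^ a)"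
      unfolding i c c_def[symmetric] P_def[symmetric] f p by simp
  qed
  finally show ?thesis .
qed

subsection \<open>Expansion near the saddle point\<close>

definition euler_prod :: "nat \<Rightarrow> complex \<Rightarrow> complex" where
  "euler_prod K z = (\<Prod>k=1..K. 1 / (1 - z ^ k))"

text \<open>The first two derivatives of \<open>log (euler_prod K (exp (- \<tau>)))\<close> at \<open>\<tau> = x\<close>, up to sign:
  mean and variance of the size of a random partition under the Boltzmann weight
  \<open>exp (- x * size)\<close>.\<close>

definition cum1 :: "nat \<Rightarrow> real \<Rightarrow> real" where
  "cum1 K x = (\<Sum>k=1..K. real k * exp (- (k * x)) / (1 - exp (- (k * x))))"

definition cum2 :: "nat \<Rightarrow> real \<Rightarrow> real" where
  "cum2 K x = (\<Sum>k=1..K. real k ^ 2 * exp (- (k * x)) / (1 - exp (- (k * x))) ^ 2)"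

lemma sum_exp_le:
  assumes "s > 0"
  shows "(\<Sum>k=1..K. exp (- (real k * s))) \<le> 1 / s"
proof -
  have "(\<Sum>k=1..K. exp (- (real k * s))) = (\<Sum>k=1..K. exp (- s) ^ k)"
    by (simp flip: exp_of_nat_mult)
  also have "\<dots> = (exp (- s) - exp (- s) ^ Suc K) / (1 - exp (- s))"
    using assms by (subst sum_gp) auto
  also have "\<dots> \<le> exp (- s) / (1 - exp (- s))"
    using assms by (intro divide_right_mono) auto
  also have "\<dots> = 1 / (exp s - 1)"
    using assms by (simp add: exp_minus field_simps)
  also have "\<dots> \<le> 1 / s"
    using assms exp_ge_add_one_self[of s] by (intro divide_left_mono mult_pos_pos) (auto simp: algebra_simps)
  finally show ?thesis .
qed

text \<open>Half of the exponential decay pays for the cubic; 216 = 6^3 comes from 1 + t <= 6 exp (t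
  / 6).\<close>

lemma one_plus_cube_exp_le:
  fixes t :: real
  assumes "t \<ge> 0"
  shows "(1 + t) ^ 3 * exp (- t) \<le> 216 * exp (- (t / 2))"
proof -
  have "(1 + t) ^ 3 \<le> (6 * exp (t / 6)) ^ 3"
  proof (rule power_mono)
    show "1 + t \<le> 6 * exp (t / 6)" using assms exp_ge_add_one_self[of "t/6"] by linarith
  qed (use assms in auto)
  also have "\<dots> = 216 * exp (t / 2)"
    by (simp add: power_mult_distrib flip: exp_of_nat_mult)
  finally have "(1 + t) ^ 3 * exp (- t) \<le> 216 * exp (t / 2) * exp (- t)"
    by (intro mult_right_mono) auto
  also have "\<dots> = 216 * exp (- (t / 2))" by (simp add: field_simps flip: exp_add)
  finally show ?thesis .
qed

lemma inverse_one_minus_exp_le: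
  fixes t :: real
  assumes "t > 0"
  shows "1 / (1 - exp (- t)) \<le> (1 + t) / t"
proof -
  have "1 + t \<le> exp t" by (rule exp_ge_add_one_self)
  then have "t \<le> (1 + t) * (1 - exp (- t))"
    using assms by (simp add: exp_minus field_simps)
  then show ?thesis using assms by (simp add: field_simps)
qed

lemma one_plus_power_exp_le:
  fixes t :: real
  assumes "t > 0" "j \<le> 3"
  shows "exp (- t) / (1 - exp (- t)) ^ j \<le> 216 * exp (- (t / 2)) / t ^ j"
proof -
  have "exp (- t) / (1 - exp (- t)) ^ j = exp (- t) * (1 / (1 - exp (- t))) ^ j"
    by (simp add: power_one_over)
  also have "\<dots> \<le> exp (- t) * ((1 + t) / t) ^ j"
    using assms by (intro mult_left_mono power_mono inverse_one_minus_exp_le) auto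
  also have "\<dots> = (1 + t) ^ j * exp (- t) / t ^ j" by (simp add: power_divide)
  also have "\<dots> \<le> (1 + t) ^ 3 * exp (- t) / t ^ j"
    using assms by (intro divide_right_mono mult_right_mono power_increasing) auto
  also have "\<dots> \<le> 216 * exp (- (t / 2)) / t ^ j"
    using assms by (intro divide_right_mono one_plus_cube_exp_le) auto
  finally show ?thesis .
qed

text \<open>Termwise, k^j cancels against (k x)^j, and what remains is x^(-j) times a geometric
  series of ratio exp (- x / 2); hence 432 = 2 * 216. The case j = 2 bounds the variance, j = 3 the
  Taylor remainder.\<close>

lemma sum_power_exp_le:
  assumes "x > 0" "j \<le> 3"
  shows "(\<Sum>k=1..K. real k ^ j * exp (- (k * x)) / (1 - exp (- (k * x))) ^ j) \<le> 432 / x ^ Suc j"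
proof -
  have "(\<Sum>k=1..K. real k ^ j * exp (- (k * x)) / (1 - exp (- (k * x))) ^ j)
      \<le> (\<Sum>k=1..K. 216 / x ^ j * exp (- (real k * (x / 2))))"
  proof (intro sum_mono)
    fix k assume k: "k \<in> {1..K}"
    have "real k ^ j * (exp (- (k * x)) / (1 - exp (- (k * x))) ^ j)
        \<le> real k ^ j * (216 * exp (- (k * x / 2)) / (k * x) ^ j)"
      using k assms by (intro mult_left_mono one_plus_power_exp_le) auto
    then show "real k ^ j * exp (- (k * x)) / (1 - exp (- (k * x))) ^ j \<le> 216 / x ^ j * exp (- (real k * (x / 2)))"
      using k assms by (simp add: power_mult_distrib)
  qed
  also have "\<dots> = 216 / x ^ j * (\<Sum>k=1..K. exp (- (real k * (x / 2))))"
    by (simp add: sum_distrib_left)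
  also have "\<dots> \<le> 216 / x ^ j * (1 / (x / 2))"
    using assms by (intro mult_left_mono sum_exp_le) auto
  finally show ?thesis by (simp add: field_simps)
qed

lemma cum2_le: "x > 0 \<Longrightarrow> cum2 K x \<le> 432 / x ^ 3"
  using sum_power_exp_le[of x 2 K] by (simp add: cum2_def eval_nat_numeral)

text \<open>The terms with k x <= 1 already suffice: there are at least 1 / (2 x) of them, and each
  is at least 1 / (3 x^2) because exp 1 <= 3.\<close>

lemma cum2_ge:
  assumes "0 < x" "x \<le> 1" "1 / x \<le> K"
  shows "cum2 K x \<ge> 1 / (6 * x ^ 3)"
proof -
  define N where "N = nat \<lfloor>1 / x\<rfloor>"
  have x1: "1 / x \<ge> 1" using assms by simp
  have N: "real N \<le> 1 / x" "1 / x < real N + 1"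
    unfolding N_def using x1 by linarith+
  have N2: "real N \<ge> 1 / (2 * x)"
  proof -
    have "\<lfloor>1 / x\<rfloor> \<ge> 1" using x1 by (simp only: one_le_floor)
    then have "real N \<ge> 1" unfolding N_def by linarith
    then have "1 / x \<le> 2 * real N" using N by linarith
    then show ?thesis by simp
  qed
  have NK: "N \<le> K" using N assms by linarith
  have "1 / (6 * x ^ 3) = 1 / (2 * x) * (1 / (3 * x ^ 2))"
    by (simp add: eval_nat_numeral)
  also have "\<dots> \<le> real N * (1 / (3 * x ^ 2))"
    using N2 by (intro mult_right_mono) auto
  also have "\<dots> = (\<Sum>k=1..N. 1 / (3 * x ^ 2))" by simp
  also have "\<dots> \<le> (\<Sum>k=1..N. real k ^ 2 * exp (- (k * x)) / (1 - exp (- (k * x))) ^ 2)"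
  proof (intro sum_mono)
    fix k assume k: "k \<in> {1..N}"
    define t where "t = k * x"
    have t: "0 < t" using k assms by (simp add: t_def)
    have "real k \<le> 1 / x" using N k by auto
    then have t1: "t \<le> 1" using assms by (simp add: t_def field_simps)
    have e: "exp (-t) \<ge> 1 / 3"
    proof -
      have "exp t \<le> exp 1" using t1 by simp
      also have "\<dots> \<le> 3" by (rule exp_le)
      finally show ?thesis by (simp add: exp_minus field_simps)
    qed
    have "1 - exp (- t) \<le> t" using exp_ge_add_one_self[of "-t"] by simp
    then have "(1 - exp (- t)) ^ 2 \<le> t ^ 2" using t by (intro power_mono) auto
    then have "(1 / 3) / t ^ 2 \<le> exp (- t) / (1 - exp (- t)) ^ 2"
      using e t by (intro frac_le) auto
    then have "real k ^ 2 * ((1 / 3) / t ^ 2) \<le> real k ^ 2 * (exp (- t) / (1 - exp (- t)) ^ 2)"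
      by (intro mult_left_mono) auto
    then show "1 / (3 * x ^ 2) \<le> real k ^ 2 * exp (- (k * x)) / (1 - exp (- (k * x))) ^ 2"
      using k by (simp add: t_def power_mult_distrib)
  qed
  also have "\<dots> \<le> cum2 K x"
    unfolding cum2_def using NK by (intro sum_mono2) auto
  finally show ?thesis .
qed

text \<open>Second-order Taylor expansion along the vertical line through x. The third derivative is
  at most 2 k^3 a / (1 - a)^3 there, and the 2 cancels the \<open>fact 2\<close> in the
  remainder.\<close>

lemma log_factor_Taylor:
  fixes x \<theta> :: real
  assumes "k > 0" "x > 0"
  defines "a \<equiv> exp (- (k * x))"
  shows "cmod (- Ln (1 - exp (- (of_nat k * (x - \<i> * \<theta>)))) - (- Ln (1 - of_real a)
           + \<i> * \<theta> * (k * a / (1 - a)) - \<theta> ^ 2 / 2 * (k ^ 2 * a / (1 - a) ^ 2)))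
         \<le> real k ^ 3 * a / (1 - a) ^ 3 * \<bar>\<theta>\<bar> ^ 3"
proof -
  define E where "E = (\<lambda>\<tau>. exp (- (of_nat k * \<tau>)) :: complex)"
  \<comment> \<open>The logarithm and its first three derivatives in \<tau>, computed from E' = - k
    E.\<close>
  define f where "f = (\<lambda>i. [\<lambda>\<tau>. - Ln (1 - E \<tau>), \<lambda>\<tau>. - (k * E \<tau> / (1 - E \<tau>)),
     \<lambda>\<tau>. k ^ 2 * E \<tau> / (1 - E \<tau>) ^ 2, \<lambda>\<tau>. - (k ^ 3 * E \<tau> * (1 + E \<tau>) / (1 - E \<tau>) ^ 3)] ! i)"
  \<comment> \<open>On this convex set |E| has the constant value a < 1, so 1 - E stays in the right
    half-plane, away from the branch cut of \<open>Ln\<close>.\<close>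
  define S where "S = {\<tau>. Re \<tau> = x}"
  have a: "0 < a" "a < 1" using assms by (auto simp: a_def)
  have nE: "cmod (E \<tau>) = a" if "\<tau> \<in> S" for \<tau>
    using that by (simp add: E_def a_def S_def norm_exp_eq_Re)
  have E1: "E \<tau> \<noteq> 1" if "\<tau> \<in> S" for \<tau> using nE[OF that] a by auto
  have dE: "(E has_field_derivative - (k * E \<tau>)) (at \<tau> within S)" for \<tau>
    unfolding E_def by (auto intro!: derivative_eq_intros)
  have ReE: "1 - E \<tau> \<notin> \<real>\<^sub>\<le>\<^sub>0" if "\<tau> \<in> S" for \<tau>
  proof -
    have "Re (E \<tau>) \<le> a" using nE[OF that] complex_Re_le_cmod[of "E \<tau>"] by simp
    then show ?thesis using a by (auto simp: complex_nonpos_Reals_iff)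
  qed
  have "cmod (f 0 (x - \<i> * \<theta>) - (\<Sum>i\<le>2. f i x * ((x - \<i> * \<theta>) - x) ^ i / fact i))
      \<le> (2 * real k ^ 3 * a / (1 - a) ^ 3) * cmod ((x - \<i> * \<theta>) - x) ^ Suc 2 / fact 2"
  proof (rule complex_Taylor)
    show "convex S" unfolding S_def by (auto simp: convex_def simp flip: distrib_right)
    show "complex_of_real x - \<i> * complex_of_real \<theta> \<in> S" "complex_of_real x \<in> S"
      by (auto simp: S_def)
    show "cmod (f (Suc 2) \<tau>) \<le> 2 * real k ^ 3 * a / (1 - a) ^ 3" if \<tau>: "\<tau> \<in> S" for \<tau>
    proof -
      have "cmod (1 + E \<tau>) \<le> 2"
        using norm_triangle_ineq[of 1 "E \<tau>"] nE[OF \<tau>] a by simp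
      moreover have m: "cmod (1 - E \<tau>) \<ge> 1 - a"
        using norm_triangle_ineq2[of 1 "E \<tau>"] nE[OF \<tau>] by simp
      moreover have "(1 - a) ^ 3 \<le> cmod (1 - E \<tau>) ^ 3" using m a by (intro power_mono) auto
      ultimately have "real k ^ 3 * a * cmod (1 + E \<tau>) / cmod (1 - E \<tau>) ^ 3 \<le> real k ^ 3 * a * 2 / (1 - a) ^ 3"
        using a by (intro frac_le mult_left_mono) auto
      then show ?thesis
        by (simp add: f_def norm_mult norm_divide norm_power nE[OF \<tau>] eval_nat_numeral mult_ac)
    qed
    show "(f i has_field_derivative f (Suc i) \<tau>) (at \<tau> within S)" if \<tau>: "\<tau> \<in> S" and "i \<le> 2" for i \<tau>
    proof -
      have ne: "1 - E \<tau> \<noteq> 0" using E1[OF \<tau>] by simp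
      consider "i = 0" | "i = 1" | "i = 2" using \<open>i \<le> 2\<close> by linarith
      then show ?thesis
      proof cases
        case 1
        then show ?thesis using ne ReE[OF \<tau>]
          by (auto simp: f_def divide_inverse mult.commute intro!: derivative_eq_intros dE)
      next
        case 2
        have "((\<lambda>\<tau>. - (k * E \<tau> / (1 - E \<tau>))) has_field_derivative
          - ((k * - (k * E \<tau>)) * (1 - E \<tau>) - (k * E \<tau>) * (k * E \<tau>)) / ((1 - E \<tau>) * (1 - E \<tau>))) (at \<tau> within S)"
          using ne by (auto intro!: derivative_eq_intros dE simp: field_simps)
        also have "- ((k * - (k * E \<tau>)) * (1 - E \<tau>) - (k * E \<tau>) * (k * E \<tau>)) / ((1 - E \<tau>) * (1 - E \<tau>)) = k ^ 2 * E \<tau> / (1 - E \<tau>) ^ 2"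
          using ne by (simp add: divide_simps power2_eq_square) (simp add: algebra_simps)
        finally show ?thesis using 2 by (simp add: f_def numeral_2_eq_2)
      next
        case 3
        have "((\<lambda>\<tau>. k ^ 2 * E \<tau> / (1 - E \<tau>) ^ 2) has_field_derivative
          ((k ^ 2 * - (k * E \<tau>)) * (1 - E \<tau>) ^ 2 - (k ^ 2 * E \<tau>) * (2 * (1 - E \<tau>) * (k * E \<tau>))) / ((1 - E \<tau>) ^ 2 * (1 - E \<tau>) ^ 2)) (at \<tau> within S)"
          using ne by (auto intro!: derivative_eq_intros dE simp: field_simps)
        also have "((k ^ 2 * - (k * E \<tau>)) * (1 - E \<tau>) ^ 2 - (k ^ 2 * E \<tau>) * (2 * (1 - E \<tau>) * (k * E \<tau>))) / ((1 - E \<tau>) ^ 2 * (1 - E \<tau>) ^ 2)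
           = - (k ^ 3 * E \<tau> * (1 + E \<tau>) / (1 - E \<tau>) ^ 3)"
          using ne by (simp add: divide_simps power2_eq_square power3_eq_cube) (simp add: algebra_simps)
        finally show ?thesis using 3 by (simp add: f_def eval_nat_numeral)
      qed
    qed
  qed
  moreover have "cmod ((x - \<i> * \<theta>) - x) = \<bar>\<theta>\<bar>" by (simp add: norm_mult)
  moreover have "E x = of_real a" by (simp add: E_def a_def exp_of_real[symmetric])
  then have "(\<Sum>i\<le>2. f i x * ((x - \<i> * \<theta>) - x) ^ i / fact i)
    = - Ln (1 - of_real a) + \<i> * \<theta> * (k * a / (1 - a)) - \<theta> ^ 2 / 2 * (k ^ 2 * a / (1 - a) ^ 2)"
    by (simp add: f_def eval_nat_numeral algebra_simps)
  moreover have "f 0 (x - \<i> * \<theta>) = - Ln (1 - exp (- (of_nat k * (x - \<i> * \<theta>))))"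
    by (simp add: f_def E_def)
  ultimately show ?thesis
    by (simp add: eval_nat_numeral)
qed

text \<open>The expansions of the logarithms of the factors are added and then exponentiated, so no
  branch has to be matched across the product. All remainders go into \<epsilon>.\<close>

lemma euler_prod_Taylor:
  fixes x \<theta> :: real
  assumes "x > 0"
  obtains \<epsilon> where "cmod \<epsilon> \<le> 432 * \<bar>\<theta>\<bar> ^ 3 / x ^ 4"
    and "euler_prod K (of_real (exp (-x)) * cis \<theta>) / euler_prod K (of_real (exp (-x)))
         = exp (\<i> * \<theta> * cum1 K x - \<theta> ^ 2 / 2 * cum2 K x + \<epsilon>)"
proof -
  define a where "a = (\<lambda>k. exp (- (real k * x)))"
  define z where "z = of_real (exp (-x)) * cis \<theta>"
  define m where "m = (\<lambda>k. real k * a k / (1 - a k))"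
  define v where "v = (\<lambda>k. real k ^ 2 * a k / (1 - a k) ^ 2)"
  define e where "e = (\<lambda>k. - Ln (1 - z ^ k) - (- Ln (1 - of_real (a k)) + \<i> * \<theta> * m k - \<theta> ^ 2 / 2 * v k))"
  have zk: "z ^ k = exp (- (of_nat k * (x - \<i> * \<theta>)))" for k
    by (simp add: z_def cis_conv_exp exp_of_real[symmetric] exp_add[symmetric] exp_of_nat_mult[symmetric] algebra_simps)
  have ak: "of_real (exp (-x)) ^ k = (of_real (a k) :: complex)" for k
    by (simp add: a_def exp_of_nat_mult[symmetric] flip: of_real_power)
  have e: "cmod (e k) \<le> \<bar>\<theta>\<bar> ^ 3 * (real k ^ 3 * exp (- (k * x)) / (1 - exp (- (k * x))) ^ 3)" if "k \<in> {1..K}" for k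
    using log_factor_Taylor[of k x \<theta>] that assms unfolding e_def zk m_def v_def a_def by (simp add: mult_ac)
  have "cmod (\<Sum>k=1..K. e k) \<le> (\<Sum>k=1..K. \<bar>\<theta>\<bar> ^ 3 * (real k ^ 3 * exp (- (k * x)) / (1 - exp (- (k * x))) ^ 3))"
    using e by (intro sum_norm_le) auto
  also have "\<dots> \<le> \<bar>\<theta>\<bar> ^ 3 * (432 / x ^ Suc 3)"
    unfolding sum_distrib_left[symmetric] using assms by (intro mult_left_mono sum_power_exp_le) auto
  finally have E: "cmod (\<Sum>k=1..K. e k) \<le> 432 * \<bar>\<theta>\<bar> ^ 3 / x ^ 4" by (simp add: mult_ac)
  have "1 / (1 - z ^ k) / (1 / (1 - of_real (a k))) = exp (\<i> * \<theta> * m k - \<theta> ^ 2 / 2 * v k + e k)" if "k \<in> {1..K}" for k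
  proof -
    have a1: "a k < 1" using that assms by (simp add: a_def)
    have "cmod (z ^ k) = a k" by (simp add: zk norm_exp_eq_Re a_def)
    then have z1: "z ^ k \<noteq> 1" using a1 by auto
    have "exp (\<i> * \<theta> * m k - \<theta> ^ 2 / 2 * v k + e k) = exp (- Ln (1 - z ^ k) + Ln (1 - of_real (a k)))"
      by (simp add: e_def)
    also have "\<dots> = inverse (1 - z ^ k) * (1 - of_real (a k))"
      using z1 a1 by (simp add: exp_diff divide_inverse mult.commute)
    finally show ?thesis by (simp add: divide_simps)
  qed
  then have "euler_prod K z / euler_prod K (of_real (exp (-x))) = (\<Prod>k=1..K. exp (\<i> * \<theta> * m k - \<theta> ^ 2 / 2 * v k + e k))"
    unfolding euler_prod_def prod_dividef[symmetric] ak by (intro prod.cong) auto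
  also have "\<dots> = exp (\<i> * \<theta> * cum1 K x - \<theta> ^ 2 / 2 * cum2 K x + (\<Sum>k=1..K. e k))"
  proof -
    have "(\<Sum>k=1..K. \<i> * \<theta> * m k - of_real (\<theta> ^ 2 / 2) * of_real (v k) + e k)
        = \<i> * \<theta> * (\<Sum>k=1..K. of_real (m k)) - of_real (\<theta> ^ 2 / 2) * (\<Sum>k=1..K. of_real (v k)) + (\<Sum>k=1..K. e k)"
      by (simp only: sum.distrib sum_subtractf sum_distrib_left[symmetric])
    moreover have "(\<Sum>k=1..K. of_real (m k)) = (of_real (cum1 K x) :: complex)" "(\<Sum>k=1..K. of_real (v k)) = (of_real (cum2 K x) :: complex)"
      by (simp_all add: cum1_def cum2_def m_def v_def a_def)
    ultimately show ?thesis
      by (subst exp_sum[symmetric]) (simp_all only: finite_atLeastAtMost of_real_mult)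
  qed
  finally show ?thesis using that E unfolding z_def by blast
qed

subsection \<open>Decay away from the saddle point\<close>

text \<open>A weak Jordan inequality. Up to pi / 3 the derivative is at least 1 / 2 - 2 / 5; beyond
  that, sin y >= sqrt 3 / 2 >= 4 / 5 and y <= 2.\<close>

lemma sin_ge_linear:
  fixes y :: real
  assumes "0 \<le> y" "y \<le> pi / 2"
  shows "sin y \<ge> 2 / 5 * y"
proof (cases "y \<le> pi / 3")
  case True
  have "(\<lambda>y. sin y - 2 / 5 * y) 0 \<le> (\<lambda>y. sin y - 2 / 5 * y) y"
  proof (rule DERIV_nonneg_imp_nondecreasing[OF assms(1)])
    fix u assume u: "0 \<le> u" "u \<le> y"
    have "cos u \<ge> cos (pi / 3)" using u True by (intro cos_monotone_0_pi_le) auto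
    then have "cos u - 2 / 5 \<ge> 0" by (simp add: cos_60)
    moreover have "((\<lambda>y. sin y - 2 / 5 * y) has_real_derivative cos u - 2 / 5) (at u)"
      by (auto intro!: derivative_eq_intros)
    ultimately show "\<exists>d. ((\<lambda>y. sin y - 2 / 5 * y) has_real_derivative d) (at u) \<and> 0 \<le> d" by blast
  qed
  then show ?thesis by simp
next
  case False
  have "sin (pi / 3) \<le> sin y" using False assms by (intro sin_monotone_2pi_le) auto
  moreover have "sqrt 3 \<ge> 8 / 5" by (rule real_le_rsqrt) (simp add: power2_eq_square)
  moreover have "y \<le> 2" using assms(2) pi_half_less_two by linarith
  ultimately show ?thesis by (simp add: sin_60)
qed

lemma one_minus_cos_ge:
  fixes \<theta> :: real
  assumes "\<bar>\<theta>\<bar> \<le> pi"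
  shows "1 - cos \<theta> \<ge> \<theta> ^ 2 / 16"
proof -
  have "(2 / 5 * (\<bar>\<theta>\<bar> / 2)) ^ 2 \<le> sin (\<bar>\<theta>\<bar> / 2) ^ 2"
    using assms by (intro power_mono sin_ge_linear) auto
  moreover have "1 - cos \<bar>\<theta>\<bar> = 2 * sin (\<bar>\<theta>\<bar> / 2) ^ 2"
    using cos_double_sin[of "\<bar>\<theta>\<bar> / 2"] by simp
  ultimately have "1 - cos \<theta> \<ge> 2 * (2 / 5 * (\<bar>\<theta>\<bar> / 2)) ^ 2" by simp
  also have "2 * (2 / 5 * (\<bar>\<theta>\<bar> / 2)) ^ 2 = 2 / 25 * \<theta> ^ 2" by (simp add: power2_eq_square)
  finally show ?thesis using zero_le_power2[of \<theta>] by linarith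
qed

lemma cmod_one_minus_cis_square:
  "cmod (1 - of_real a * cis \<phi>) ^ 2 = (1 - a) ^ 2 + 2 * a * (1 - cos \<phi>)"
proof -
  have "cmod (1 - of_real a * cis \<phi>) ^ 2 = (1 - a * cos \<phi>) ^ 2 + a ^ 2 * (1 - cos \<phi> ^ 2)"
    by (simp add: cmod_power2 power_mult_distrib sin_squared_eq)
  then show ?thesis by (simp add: power2_eq_square algebra_simps)
qed

text \<open>The square of the left side is 1 - 2 a w / N with w = 1 - cos \<phi>, so 1 + u <= exp u
  applies; N <= (1 + a)^2 <= 4 makes the exponent free of N.\<close>

lemma one_minus_div_le_exp:
  fixes a \<phi> :: real
  assumes "0 \<le> a" "a < 1"
  shows "(1 - a) / cmod (1 - of_real a * cis \<phi>) \<le> exp (- (a * (1 - cos \<phi>) / 4))"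
proof -
  define w where "w = 1 - cos \<phi>"
  define N where "N = cmod (1 - of_real a * cis \<phi>) ^ 2"
  have w: "0 \<le> w" "w \<le> 2" by (auto simp: w_def) 
  have N: "N = (1 - a) ^ 2 + 2 * a * w"
    unfolding N_def w_def by (rule cmod_one_minus_cis_square)
  have "2 * a * w \<le> 2 * a * 2" using w assms by (intro mult_left_mono) auto
  then have "N \<le> (1 + a) ^ 2" unfolding N by (simp add: power2_eq_square algebra_simps)
  also have "\<dots> \<le> 2 ^ 2" using assms by (intro power_mono) auto
  finally have N4: "N \<le> 4" by simp
  have Npos: "N > 0" unfolding N using assms w by (intro add_pos_nonneg) auto
  have "((1 - a) / cmod (1 - of_real a * cis \<phi>)) ^ 2 = (1 - a) ^ 2 / N"
    by (simp add: N_def power_divide)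
  also have "\<dots> = 1 + (- (2 * a * w / N))" using Npos by (simp add: N field_simps)
  also have "\<dots> \<le> exp (- (2 * a * w / N))" by (rule exp_ge_add_one_self)
  also have "\<dots> \<le> exp (- (2 * a * w / 4))"
    using N4 Npos w assms by (simp only: exp_le_cancel_iff neg_le_iff_le) (intro divide_left_mono mult_pos_pos, auto)
  also have "\<dots> = exp (- (a * w / 4)) ^ 2" by (simp flip: exp_of_nat_mult)
  finally show ?thesis unfolding w_def by (rule power2_le_imp_le) simp
qed

text \<open>Reduces the decay of the product to a lower bound for a sum that is the real part of a
  difference of two geometric sums.\<close>

lemma norm_euler_prod_le:
  assumes "0 < x"
  shows "cmod (euler_prod K (of_real (exp (-x)) * cis \<theta>) / euler_prod K (of_real (exp (-x))))
         \<le> exp (- ((\<Sum>k=1..K. exp (-x) ^ k * (1 - cos (k * \<theta>))) / 4))"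
proof -
  define r where "r = exp (-x)"
  have r: "0 < r" "r < 1" using assms by (auto simp: r_def)
  have "cmod (euler_prod K (of_real r * cis \<theta>) / euler_prod K (of_real r))
     = (\<Prod>k=1..K. (1 - r ^ k) / cmod (1 - of_real (r ^ k) * cis (k * \<theta>)))"
    unfolding euler_prod_def prod_dividef[symmetric] prod_norm[symmetric]
  proof (intro prod.cong refl)
    fix k assume "k \<in> {1..K}"
    then have "r ^ k < 1" using r by (auto simp: power_less_one_iff)
    then have "cmod (1 - of_real r ^ k) = 1 - r ^ k"
      by (metis abs_of_pos diff_gt_0_iff_gt norm_of_real of_real_1 of_real_diff of_real_power)
    then show "cmod (1 / (1 - (of_real r * cis \<theta>) ^ k) / (1 / (1 - of_real r ^ k))) = (1 - r ^ k) / cmod (1 - of_real (r ^ k) * cis (k * \<theta>))"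
      by (simp add: norm_divide power_mult_distrib Complex.DeMoivre)
  qed
  also have "\<dots> \<le> (\<Prod>k=1..K. exp (- (r ^ k * (1 - cos (k * \<theta>)) / 4)))"
    using r by (intro prod_mono conjI one_minus_div_le_exp) (auto simp: power_less_one_iff power_le_one)
  also have "\<dots> = exp (- ((\<Sum>k=1..K. r ^ k * (1 - cos (k * \<theta>))) / 4))"
    by (simp add: exp_sum[symmetric] sum_negf sum_divide_distrib)
  finally show ?thesis unfolding r_def .
qed

text \<open>Up to truncation the sum is 1 / (1 - r) - Re (1 / (1 - z)), which has a closed form in
  \<delta> = 1 - r and D, since |1 - z|^2 = \<delta>^2 + D. Each of the two geometric tails costs at
  most r^(K+1) / \<delta>.\<close>

lemma sum_one_minus_cos_ge:
  assumes x: "0 < x" "x \<le> 1" and \<theta>: "\<bar>\<theta>\<bar> \<le> pi"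
  shows "(\<Sum>k=1..K. exp (-x) ^ k * (1 - cos (k * \<theta>))) \<ge> \<theta> ^ 2 / (50 * x * (x ^ 2 + \<theta> ^ 2)) - 2 * exp (-x) ^ Suc K / (1 - exp (-x))"
proof -
  define r where "r = exp (-x)"
  define z where "z = of_real r * cis \<theta>"
  define \<delta> where "\<delta> = 1 - r"
  define D where "D = 2 * r * (1 - cos \<theta>)"
  have r: "0 < r" "r < 1" using x by (auto simp: r_def)
  have r3: "r \<ge> 1 / 3"
  proof -
    have "exp x \<le> exp 1" using x by simp
    also have "\<dots> \<le> 3" by (rule exp_le)
    finally show ?thesis by (simp add: r_def exp_minus field_simps)
  qed
  have \<delta>: "0 < \<delta>" "\<delta> \<le> x" "\<delta> < 1" using r exp_ge_add_one_self[of "-x"] by (auto simp: \<delta>_def r_def)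
  have D: "D \<ge> \<theta> ^ 2 / 24"
  proof -
    have "\<theta> ^ 2 / 24 = 2 * (1 / 3) * (\<theta> ^ 2 / 16)" by simp
    also have "\<dots> \<le> D" unfolding D_def using r3 r one_minus_cos_ge[OF \<theta>] by (intro mult_mono) auto
    finally show ?thesis .
  qed
  then have D0: "D \<ge> 0" by (smt (verit) divide_nonneg_nonneg zero_le_power2)
  have nz: "cmod z = r" using r by (simp add: z_def norm_mult)
  then have z1: "1 - z \<noteq> 0" using r by auto
  have N: "cmod (1 - z) ^ 2 = \<delta> ^ 2 + D"
    unfolding z_def \<delta>_def D_def by (rule cmod_one_minus_cis_square)
  have Npos: "\<delta> ^ 2 + D > 0" using \<delta> D0 by (intro add_pos_nonneg) auto
  \<comment> \<open>The term for k = 0 vanishes, so it can be added to obtain full geometric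
    sums.\<close>
  have "(\<Sum>k=1..K. r ^ k * (1 - cos (k * \<theta>))) = (\<Sum>k<Suc K. r ^ k * (1 - cos (k * \<theta>)))"
    by (subst sum.lessThan_Suc_shift) (simp add: sum.atLeast1_atMost_eq)
  also have "\<dots> = (\<Sum>k<Suc K. r ^ k - Re (z ^ k))"
    by (intro sum.cong refl)
       (simp add: z_def power_mult_distrib Complex.DeMoivre right_diff_distrib flip: of_real_power)
  also have "\<dots> = (\<Sum>k<Suc K. r ^ k) - Re (\<Sum>k<Suc K. z ^ k)"
    by (simp only: sum_subtractf Re_sum)
  also have "(\<Sum>k<Suc K. r ^ k) = 1 / \<delta> - r ^ Suc K / \<delta>"
    using r by (subst sum_gp_strict) (auto simp: \<delta>_def diff_divide_distrib)
  also have "(\<Sum>k<Suc K. z ^ k) = 1 / (1 - z) - z ^ Suc K / (1 - z)"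
    using z1 by (subst sum_gp_strict) (auto simp: diff_divide_distrib)
  also have "Re \<dots> = Re (1 / (1 - z)) - Re (z ^ Suc K / (1 - z))" by simp
  also have "Re (1 / (1 - z)) = (\<delta> + D / 2) / (\<delta> ^ 2 + D)"
  proof -
    have "Re (1 / (1 - z)) = Re (1 - z) / cmod (1 - z) ^ 2" by (simp add: Re_divide cmod_power2)
    also have "Re (1 - z) = \<delta> + D / 2" by (simp add: z_def \<delta>_def D_def field_simps)
    finally show ?thesis by (simp add: N)
  qed
  finally have eq: "(\<Sum>k=1..K. r ^ k * (1 - cos (k * \<theta>))) = 1 / \<delta> - (\<delta> + D / 2) / (\<delta> ^ 2 + D) - r ^ Suc K / \<delta> + Re (z ^ Suc K / (1 - z))"
    by simp
  have tail: "Re (z ^ Suc K / (1 - z)) \<ge> - (r ^ Suc K / \<delta>)"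
  proof -
    have "cmod (1 - z) \<ge> \<delta>" using norm_triangle_ineq2[of 1 z] nz by (simp add: \<delta>_def)
    then have "cmod (z ^ Suc K / (1 - z)) \<le> r ^ Suc K / \<delta>"
      unfolding norm_divide norm_power nz using \<delta> r by (intro divide_left_mono mult_pos_pos) auto
    then show ?thesis using abs_Re_le_cmod[of "z ^ Suc K / (1 - z)"] by linarith
  qed
  \<comment> \<open>From \<theta>^2 <= 24 D and \<delta> <= x one gets \<theta>^2 (\<delta>^2 + D)
    <= 25 D (x^2 + \<theta>^2); the 50 is twice this 25.\<close>
  have "\<theta> ^ 2 / (50 * x * (x ^ 2 + \<theta> ^ 2)) \<le> D / (2 * \<delta> * (\<delta> ^ 2 + D))"
  proof (cases "\<theta> = 0")
    case True then show ?thesis using \<delta> D0 Npos by simp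
  next
    case False
    then have t: "\<theta> ^ 2 > 0" by simp
    have "D > 0" using D t by (smt (verit) divide_pos_pos)
    have "\<delta> ^ 2 \<le> x ^ 2" using \<delta> by (intro power_mono) auto
    moreover have "\<theta> ^ 2 * \<delta> ^ 2 \<le> (24 * D) * x ^ 2"
      using calculation D D0 by (intro mult_mono) auto
    moreover have "D * x ^ 2 \<ge> 0" "D * \<theta> ^ 2 \<ge> 0" using D0 by auto
    ultimately have "\<theta> ^ 2 * (\<delta> ^ 2 + D) \<le> D * (25 * (x ^ 2 + \<theta> ^ 2))"
      by (simp add: algebra_simps)
    moreover have "25 * (x ^ 2 + \<theta> ^ 2) > 0" using t by (simp add: add_nonneg_pos)
    ultimately have "\<theta> ^ 2 / (25 * (x ^ 2 + \<theta> ^ 2)) \<le> D / (\<delta> ^ 2 + D)"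
      using Npos by (simp only: pos_divide_le_eq times_divide_eq_left pos_le_divide_eq)
    moreover have "1 / (2 * x) \<le> 1 / (2 * \<delta>)" using \<delta> x by (intro divide_left_mono) auto
    ultimately have "\<theta> ^ 2 / (25 * (x ^ 2 + \<theta> ^ 2)) * (1 / (2 * x)) \<le> D / (\<delta> ^ 2 + D) * (1 / (2 * \<delta>))"
      using x D0 Npos by (intro mult_mono) (assumption | simp)+
    then show ?thesis by (simp add: mult_ac)
  qed
  also have "\<dots> \<le> 1 / \<delta> - (\<delta> + D / 2) / (\<delta> ^ 2 + D)"
  proof -
    have "1 / \<delta> - (\<delta> + D / 2) / (\<delta> ^ 2 + D) = D * (1 - \<delta> / 2) / (\<delta> * (\<delta> ^ 2 + D))"
      using \<delta> Npos by (simp add: field_simps power2_eq_square)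
    moreover have "D * (1 - \<delta> / 2) / (\<delta> * (\<delta> ^ 2 + D)) \<ge> D * (1 / 2) / (\<delta> * (\<delta> ^ 2 + D))"
      using \<delta> Npos D0 by (intro divide_right_mono mult_left_mono) auto
    ultimately show ?thesis by simp
  qed
  finally show ?thesis using eq tail unfolding r_def[symmetric] \<delta>_def[symmetric] by simp
qed

subsection \<open>Location of the saddle point\<close>

lemma sinh_ge_self:
  fixes y :: real
  assumes "y \<ge> 0"
  shows "sinh y \<ge> y"
proof -
  have "(\<lambda>y. sinh y - y) 0 \<le> (\<lambda>y. sinh y - y) y"
    by (rule DERIV_nonneg_imp_nondecreasing[OF assms])
       (auto intro!: exI derivative_eq_intros simp: cosh_real_ge_1)
  then show ?thesis by simp
qed

lemma sinh_le_mult_cosh: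
  fixes y :: real
  assumes "y \<ge> 0"
  shows "sinh y \<le> y * cosh y"
proof -
  have "(\<lambda>y. y * cosh y - sinh y) 0 \<le> (\<lambda>y. y * cosh y - sinh y) y"
  proof (rule DERIV_nonneg_imp_nondecreasing[OF assms])
    fix u :: real assume "0 \<le> u"
    then show "\<exists>d. ((\<lambda>y. y * cosh y - sinh y) has_real_derivative d) (at u) \<and> 0 \<le> d"
      by (intro exI[of _ "u * sinh u"]) (auto intro!: derivative_eq_intros)
  qed
  then show ?thesis by simp
qed

lemma exp_div_square_eq_sinh:
  fixes t :: real
  shows "exp (- t) / (1 - exp (- t)) ^ 2 = 1 / (4 * sinh (t / 2) ^ 2)"
proof -
  define e where "e = exp (- (t / 2))"
  have e: "exp (- t) = e ^ 2" by (simp add: e_def flip: exp_of_nat_mult)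
  have "exp (t / 2) = 1 / e" by (simp add: e_def exp_minus inverse_eq_divide)
  then have "sinh (t / 2) = (1 / e - e) / 2"
    unfolding sinh_field_def e_def[symmetric] by simp
  then have s: "2 * sinh (t / 2) = 1 / e - e" by simp
  have "1 - e ^ 2 = e * (2 * sinh (t / 2))"
    unfolding s right_diff_distrib power2_eq_square by (simp add: e_def)
  then have "(1 - e ^ 2) ^ 2 = e ^ 2 * (4 * sinh (t / 2) ^ 2)"
    by (simp add: power_mult_distrib)
  then show ?thesis unfolding e by (simp add: e_def)
qed

text \<open>With s = sinh (t / 2) the quotient is 1 / (4 s^2). The first bound is s >= t / 2. For
  the second, s <= (t / 2) cosh (t / 2) and cosh^2 = 1 + s^2 keep the difference below 1 / 4, and it
  is trivially below 1 / t^2. The form 2 / (1 + t^2) covers both and sums to O(1 / x) over t = m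
  x.\<close>

lemma exp_div_square_bounds:
  fixes t :: real
  assumes "t > 0"
  shows "exp (- t) / (1 - exp (- t)) ^ 2 \<le> 1 / t ^ 2"
    and "1 / t ^ 2 - exp (- t) / (1 - exp (- t)) ^ 2 \<le> 2 / (1 + t ^ 2)"
proof -
  define s where "s = sinh (t / 2)"
  have s: "s \<ge> t / 2" "s \<le> t / 2 * cosh (t / 2)" "s > 0"
    using assms sinh_ge_self[of "t / 2"] sinh_le_mult_cosh[of "t / 2"] by (auto simp: s_def)
  have h: "exp (- t) / (1 - exp (- t)) ^ 2 = 1 / (4 * s ^ 2)"
    unfolding s_def by (rule exp_div_square_eq_sinh)
  have "(t / 2) ^ 2 \<le> s ^ 2" using s assms by (intro power_mono) auto
  then have "t ^ 2 \<le> 4 * s ^ 2" by (simp add: power2_eq_square)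
  then show "exp (- t) / (1 - exp (- t)) ^ 2 \<le> 1 / t ^ 2"
    unfolding h using assms s by (intro divide_left_mono) auto
  have "s ^ 2 \<le> (t / 2 * cosh (t / 2)) ^ 2" using s by (intro power_mono) auto
  also have "\<dots> = t ^ 2 / 4 * (1 + s ^ 2)"
    by (simp add: power_mult_distrib power_divide cosh_square_eq s_def algebra_simps)
  finally have "4 * s ^ 2 \<le> t ^ 2 * (1 + s ^ 2)" by simp
  then have "1 / t ^ 2 - 1 / (4 * s ^ 2) \<le> 1 / 4"
    using assms s by (simp add: field_simps)
  moreover have "1 / t ^ 2 - 1 / (4 * s ^ 2) \<le> 1 / t ^ 2" by simp
  moreover have "min (1 / 4) (1 / t ^ 2) \<le> 2 / (1 + t ^ 2)"
  proof (cases "t \<le> 1")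
    case True
    then have "t ^ 2 \<le> 1" using assms by (simp add: power_le_one)
    then have "(1 :: real) / 4 \<le> 2 / (1 + t ^ 2)" by (simp add: field_simps add_pos_nonneg)
    then show ?thesis by simp
  next
    case False
    then have "t ^ 2 \<ge> 1" by (simp add: one_le_power)
    then have "1 / t ^ 2 \<le> 2 / (1 + t ^ 2)" using assms by (simp add: field_simps add_pos_nonneg)
    then show ?thesis by simp
  qed
  ultimately show "1 / t ^ 2 - exp (- t) / (1 - exp (- t)) ^ 2 \<le> 2 / (1 + t ^ 2)"
    unfolding h by linarith
qed

text \<open>A Riemann sum with right endpoints of a decreasing function: x times a term is at most
  the increment of \<open>arctan\<close> over its cell, and the increments telescope.\<close>

lemma sum_inverse_one_plus_square_le:
  fixes x :: real
  assumes "x > 0"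
  shows "(\<Sum>m<N. 1 / (1 + (real (Suc m) * x) ^ 2)) \<le> pi / (2 * x)"
proof -
  have "x * (1 / (1 + (real (Suc m) * x) ^ 2)) \<le> arctan (real (Suc m) * x) - arctan (real m * x)" for m
  proof -
    have "real m * x < real (Suc m) * x" using assms by simp
    from MVT2[OF this, of arctan "\<lambda>y. inverse (1 + y ^ 2)"]
    obtain y where y: "real m * x < y" "y < real (Suc m) * x"
      and eq: "arctan (real (Suc m) * x) - arctan (real m * x) = (real (Suc m) * x - real m * x) * inverse (1 + y ^ 2)"
      using DERIV_arctan by blast
    have "0 \<le> real m * x" using assms by simp
    then have "y ^ 2 \<le> (real (Suc m) * x) ^ 2" using y by (intro power_mono) auto
    then have "1 / (1 + (real (Suc m) * x) ^ 2) \<le> inverse (1 + y ^ 2)"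
      unfolding inverse_eq_divide by (intro divide_left_mono mult_pos_pos add_pos_nonneg) auto
    moreover have "real (Suc m) * x - real m * x = x" by (simp add: algebra_simps)
    ultimately show ?thesis unfolding eq using assms by (simp only: mult_left_mono less_imp_le)
  qed
  then have "x * (\<Sum>m<N. 1 / (1 + (real (Suc m) * x) ^ 2)) \<le> (\<Sum>m<N. arctan (real (Suc m) * x) - arctan (real m * x))"
    unfolding sum_distrib_left by (intro sum_mono)
  also have "\<dots> = arctan (real N * x) - arctan (real 0 * x)"
    by (rule sum_lessThan_telescope)
  also have "\<dots> \<le> pi / 2" using arctan_ubound[of "real N * x"] by simp
  finally show ?thesis using assms by (simp add: field_simps)
qed

text \<open>Both sides are iterated sums of the double series \<open>\<Sum>k m. k * exp (- k * m * x)\<close>.\<close>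

lemma cum1_swap:
  fixes x :: real
  assumes "x > 0" "(\<lambda>m. exp (- (real (Suc m) * x)) / (1 - exp (- (real (Suc m) * x))) ^ 2) sums S"
  shows "(\<lambda>K. cum1 K x) \<longlonglongrightarrow> S"
proof -
  define q where "q = exp (-x)"
  have q: "0 < q" "q < 1" using assms by (auto simp: q_def)
  have qk: "exp (- (real k * x)) = q ^ k" for k by (simp add: q_def flip: exp_of_nat_mult)
  have qk1: "q ^ Suc k < 1" for k using q by (simp only: power_less_one_iff) simp
  define f where "f = (\<lambda>(m, k). real (Suc k) * q ^ (Suc m * Suc k))"
  define g where "g = (\<lambda>k. real (Suc k) * q ^ Suc k / (1 - q ^ Suc k))"
  define h where "h = (\<lambda>m. q ^ Suc m / (1 - q ^ Suc m) ^ 2)"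
  have fh: "((\<lambda>k. f (m, k)) has_sum h m) UNIV" for m
  proof (rule sums_nonneg_imp_has_sum)
    have "norm (q ^ Suc m) < 1" using q qk1 by (simp add: norm_power del: power_Suc)
    from sums_mult[OF geometric_deriv_sums[OF this], of "q ^ Suc m"]
    show "(\<lambda>k. f (m, k)) sums h m"
      by (simp add: f_def h_def power_mult[symmetric] power_add[symmetric] algebra_simps)
  qed (use q in \<open>auto simp: f_def\<close>)
  have fg: "((\<lambda>m. f (m, k)) has_sum g k) UNIV" for k
  proof (rule sums_nonneg_imp_has_sum)
    have "norm (q ^ Suc k) < 1" using q qk1 by (simp add: norm_power del: power_Suc)
    from sums_mult[OF geometric_sums[OF this], of "real (Suc k) * q ^ Suc k"]
    show "(\<lambda>m. f (m, k)) sums g k"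
      by (simp add: f_def g_def power_mult[symmetric] power_add[symmetric] algebra_simps add_divide_distrib)
  qed (use q in \<open>auto simp: f_def\<close>)
  have "h sums S" using assms(2) by (simp only: qk h_def)
  then have hS: "(h has_sum S) UNIV" by (rule sums_nonneg_imp_has_sum) (use q in \<open>auto simp: h_def\<close>)
  \<comment> \<open>All terms are nonnegative, so summable row sums give unconditional summability
    of the double family, and the column sums have the same total.\<close>
  have "f summable_on UNIV \<times> UNIV"
    by (rule summable_on_SigmaI[where g = h]) (use fh hS q in \<open>auto simp: f_def has_sum_imp_summable\<close>)
  then have "(f has_sum S) (UNIV \<times> UNIV)"
    by (intro has_sum_SigmaI[OF fh hS]) auto
  then have "((\<lambda>(k, m). f (m, k)) has_sum S) (UNIV \<times> UNIV)"
    by (subst (asm) has_sum_swap)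
  then have "(g has_sum S) UNIV"
    by (rule has_sum_SigmaD) (use fg in auto)
  then have "(\<lambda>K. \<Sum>k<K. g k) \<longlonglongrightarrow> S"
    using has_sum_imp_sums sums_def by blast
  moreover have "(\<Sum>k<K. g k) = cum1 K x" for K
    by (simp add: cum1_def g_def qk sum.atLeast1_atMost_eq del: power_Suc of_nat_Suc)
  ultimately show ?thesis by simp
qed

text \<open>After the exchange of sums the mean is compared term by term with the sum of 1 / (m
  x)^2, which is pi^2 / (6 x^2). The error pi / x is the sum of the differences, and the 1 pays for
  the truncation at \<open>K\<close>.\<close>

lemma eventually_cum1_approx:
  fixes x :: real
  assumes "x > 0"
  shows "\<forall>\<^sub>F K in sequentially. \<bar>cum1 K x - pi ^ 2 / (6 * x ^ 2)\<bar> \<le> pi / x + 1"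
proof -
  define t where "t = (\<lambda>m. real (Suc m) * x)"
  define h where "h = (\<lambda>m. exp (- t m) / (1 - exp (- t m)) ^ 2)"
  have t: "t m > 0" for m using assms by (simp add: t_def)
  have sq: "(\<lambda>m. 1 / t m ^ 2) sums (pi ^ 2 / (6 * x ^ 2))"
    using sums_mult2[OF inverse_squares_sums, of "1 / x ^ 2"]
    by (simp add: t_def power_mult_distrib add.commute)
  have h0: "h m \<ge> 0" for m by (simp add: h_def)
  have h1: "h m \<le> 1 / t m ^ 2" for m using exp_div_square_bounds(1)[OF t] by (simp add: h_def)
  have hs: "summable h"
    by (rule summable_comparison_test'[OF sums_summable[OF sq]]) (simp only: real_norm_def abs_of_nonneg[OF h0] h1)
  have S: "(\<lambda>m. 1 / t m ^ 2 - h m) sums (pi ^ 2 / (6 * x ^ 2) - suminf h)"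
    by (rule sums_diff[OF sq summable_sums[OF hs]])
  have "pi ^ 2 / (6 * x ^ 2) - suminf h \<le> pi / x"
    unfolding sums_unique[OF S]
  proof (rule suminf_le_const[OF sums_summable[OF S]])
    show "(\<Sum>m<N. 1 / t m ^ 2 - h m) \<le> pi / x" for N
    proof -
      have "(\<Sum>m<N. 1 / t m ^ 2 - h m) \<le> (\<Sum>m<N. 2 * (1 / (1 + (real (Suc m) * x) ^ 2)))"
        using exp_div_square_bounds(2)[OF t] by (intro sum_mono) (simp add: h_def t_def)
      also have "\<dots> \<le> 2 * (pi / (2 * x))"
        unfolding sum_distrib_left[symmetric] using assms
        by (intro mult_left_mono sum_inverse_one_plus_square_le) auto
      finally show ?thesis by simp
    qed
  qed
  moreover have "pi ^ 2 / (6 * x ^ 2) - suminf h \<ge> 0"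
    by (rule sums_le[OF _ sums_zero S]) (use h1 in simp)
  ultimately have "\<bar>suminf h - pi ^ 2 / (6 * x ^ 2)\<bar> \<le> pi / x" by linarith
  moreover have "(\<lambda>K. cum1 K x) \<longlonglongrightarrow> suminf h"
    using assms hs by (intro cum1_swap) (auto simp: h_def t_def summable_sums)
  then have "\<forall>\<^sub>F K in sequentially. dist (cum1 K x) (suminf h) < 1"
    by (rule tendstoD) simp
  ultimately show ?thesis by (elim eventually_mono) (simp add: dist_real_def)
qed

subsection \<open>Dominated convergence at the saddle point\<close>

lemma cmod_one_minus_cis_le: "cmod (1 - cis \<phi>) \<le> \<bar>\<phi>\<bar>"
proof (rule power2_le_imp_le)
  have "cmod (1 - cis \<phi>) ^ 2 = 2 * (1 - cos \<phi>)"
    using cmod_one_minus_cis_square[of 1 \<phi>] by simp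
  also have "\<dots> = 4 * \<bar>sin (\<phi> / 2)\<bar> ^ 2"
    using cos_double_sin[of "\<phi> / 2"] by simp
  also have "\<dots> \<le> 4 * \<bar>\<phi> / 2\<bar> ^ 2"
    by (intro mult_left_mono power_mono abs_sin_x_le_abs_x) auto
  finally show "cmod (1 - cis \<phi>) ^ 2 \<le> \<bar>\<phi>\<bar> ^ 2" by (simp add: power2_eq_square)
qed auto

text \<open>The difference is a (1 - cis (s \<theta>)) / (1 - a) with a / (1 - a) = 1 / (exp (s x) -
  1) <= 1 / (s x), and a chord is at most its arc, so s cancels. The bound serves twice: it tends to
  0 when \<theta> = o(x), and it is polynomial in 1 / x for all other angles.\<close>

lemma factor_ratio_bound:
  fixes x \<theta> :: real
  assumes "x > 0" "s > 0"
  shows "cmod ((1 - (of_real (exp (-x)) * cis \<theta>) ^ s) / (1 - of_real (exp (-x)) ^ s) - 1) \<le> \<bar>\<theta>\<bar> / x"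
proof -
  define a where "a = exp (- (real s * x))"
  have sx: "real s * x > 0" using assms by simp
  have a: "0 < a" "a < 1" using sx by (auto simp: a_def)
  have rs: "of_real (exp (-x)) ^ s = (of_real a :: complex)"
    by (simp add: a_def flip: of_real_power exp_of_nat_mult)
  have a1: "1 - of_real a = (of_real (1 - a) :: complex)" by simp
  have "(1 - (of_real (exp (-x)) * cis \<theta>) ^ s) / (1 - of_real (exp (-x)) ^ s) - 1
      = of_real a * (1 - cis (s * \<theta>)) / of_real (1 - a)"
    using a unfolding power_mult_distrib rs Complex.DeMoivre a1
    by (simp add: field_simps del: of_real_diff) (simp add: algebra_simps)
  also have "cmod \<dots> = a / (1 - a) * cmod (1 - cis (s * \<theta>))"
    using a by (simp add: norm_mult norm_divide del: of_real_diff)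
  also have "\<dots> \<le> 1 / (s * x) * \<bar>s * \<theta>\<bar>"
  proof (intro mult_mono cmod_one_minus_cis_le)
    have "a / (1 - a) = 1 / (exp (s * x) - 1)" using a by (simp add: a_def exp_minus field_simps)
    also have "\<dots> \<le> 1 / (s * x)"
    proof (rule frac_le[OF _ _ sx])
      show "s * x \<le> exp (s * x) - 1" using exp_ge_add_one_self[of "s * x"] by linarith
    qed auto
    finally show "a / (1 - a) \<le> 1 / (s * x)" .
  qed (use a sx in auto)
  also have "\<dots> = \<bar>\<theta>\<bar> / x" using assms by (simp add: abs_mult)
  finally show ?thesis .
qed

lemma integrable_inverse_one_plus_square: "(\<lambda>u::real. 1 / (1 + u ^ 2)) integrable_on UNIV"
proof -
  define f where "f = (\<lambda>k::nat. \<lambda>u::real. if u \<in> {- real k..real k} then 1 / (1 + u ^ 2) else 0)"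
  have i: "(f k has_integral 2 * arctan k) UNIV" for k
  proof -
    have "((\<lambda>u. 1 / (1 + u ^ 2)) has_integral (arctan k - arctan (- real k))) {- real k..real k}"
      by (rule fundamental_theorem_of_calculus)
         (use has_field_derivative_at_within[OF DERIV_arctan] in
           \<open>auto simp: inverse_eq_divide simp flip: has_real_derivative_iff_has_vector_derivative\<close>)
    then show ?thesis unfolding f_def has_integral_restrict_UNIV by (simp add: arctan_minus)
  qed
  show ?thesis
  proof (rule conjunct1[OF monotone_convergence_increasing[where f = f]])
    show "f k integrable_on UNIV" for k using i by blast
    show "f k u \<le> f (Suc k) u" for k u by (auto simp: f_def)
    show "(\<lambda>k. f k u) \<longlonglongrightarrow> 1 / (1 + u ^ 2)" for u
    proof (rule tendsto_eventually)
      have "\<forall>\<^sub>F k in sequentially. real k \<ge> \<bar>u\<bar>" by real_asymp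
      then show "\<forall>\<^sub>F k in sequentially. f k u = 1 / (1 + u ^ 2)"
        by (rule eventually_mono) (auto simp: f_def)
    qed
    show "bounded (range (\<lambda>k. integral UNIV (f k)))"
    proof (rule boundedI)
      fix y assume "y \<in> range (\<lambda>k. integral UNIV (f k))"
      then obtain k :: nat where "y = 2 * arctan k" using integral_unique[OF i] by auto
      then show "norm y \<le> pi" using arctan_bounded[of "real k"] by (simp add: abs_le_iff)
    qed
  qed
qed

lemma power_le_mult_exp:
  fixes y :: real
  assumes "y \<ge> 0" "m > 0"
  shows "y ^ m \<le> real m ^ m * exp y"
proof -
  have "y / m \<le> exp (y / m)" using exp_ge_add_one_self[of "y / m"] by linarith
  then have "y \<le> m * exp (y / m)" using assms by (simp add: field_simps)
  then have "y ^ m \<le> (m * exp (y / m)) ^ m" using assms by (intro power_mono) auto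
  also have "\<dots> = real m ^ m * exp y" using assms by (simp add: power_mult_distrib flip: exp_of_nat_mult)
  finally show ?thesis .
qed

text \<open>In the rescaled variable \<open>u\<close>, where \<open>u\<^sup>2 \<le> 432 * \<theta>\<^sup>2 / x ^ 3\<close> by \<open>cum2_le\<close>, this makes
  \<open>1 / (1 + u\<^sup>2)\<close> an integrable majorant of the integrands.\<close>

lemma tail_domination:
  "\<exists>B. \<forall>x \<theta>. 0 < x \<and> x \<le> 1 \<and> \<bar>\<theta>\<bar> \<le> pi \<longrightarrow>
     exp (- (\<theta> ^ 2 / (200 * x * (x ^ 2 + \<theta> ^ 2)))) * (1 + \<bar>\<theta>\<bar> / x) ^ t * (1 + 432 * \<theta> ^ 2 / x ^ 3) \<le> B"
proof -
  \<comment> \<open>The power of 1 / x to be absorbed at large angles: t from the factors for S and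
    3 from \<theta>^2 / x^3. The two entries of B belong to |\<theta>| <= x and |\<theta>| >
    x.\<close>
  define m where "m = t + 3"
  define B where "B = max (2 ^ t * 172800) (5 ^ t * 6913 * (400 ^ m * real m ^ m))"
  show ?thesis
  proof (rule exI[of _ B], intro allI impI)
    fix x \<theta> :: real assume *: "0 < x \<and> x \<le> 1 \<and> \<bar>\<theta>\<bar> \<le> pi"
    then have x: "0 < x" "x \<le> 1" and \<theta>: "\<bar>\<theta>\<bar> \<le> pi" by auto
    have pos: "x ^ 2 + \<theta> ^ 2 > 0" using x by (intro add_pos_nonneg) auto
    show "exp (- (\<theta> ^ 2 / (200 * x * (x ^ 2 + \<theta> ^ 2)))) * (1 + \<bar>\<theta>\<bar> / x) ^ t * (1 + 432 * \<theta> ^ 2 / x ^ 3) \<le> B"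
    proof (cases "\<bar>\<theta>\<bar> \<le> x")
      case True
      \<comment> \<open>Gaussian range: the exponent is at least v / 400 and the factors for S stay
        below 2^t. The constant 172800 is 432 * 400.\<close>
      define v where "v = \<theta> ^ 2 / x ^ 3"
      have v: "v \<ge> 0" using x by (simp add: v_def)
      have sq: "\<theta> ^ 2 \<le> x ^ 2" using True x by (metis abs_ge_zero power2_abs power_mono)
      have "v / 400 = \<theta> ^ 2 / (200 * x * (2 * x ^ 2))" by (simp add: v_def eval_nat_numeral)
      also have "\<dots> \<le> \<theta> ^ 2 / (200 * x * (x ^ 2 + \<theta> ^ 2))"
        using x pos sq by (intro divide_left_mono mult_left_mono mult_pos_pos) auto
      finally have e: "exp (- (\<theta> ^ 2 / (200 * x * (x ^ 2 + \<theta> ^ 2)))) \<le> exp (- (v / 400))" by simp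
      have p: "(1 + \<bar>\<theta>\<bar> / x) ^ t \<le> 2 ^ t"
        using True x by (intro power_mono) (auto simp: field_simps)
      have "exp (- (\<theta> ^ 2 / (200 * x * (x ^ 2 + \<theta> ^ 2)))) * (1 + \<bar>\<theta>\<bar> / x) ^ t * (1 + 432 * \<theta> ^ 2 / x ^ 3)
         = exp (- (\<theta> ^ 2 / (200 * x * (x ^ 2 + \<theta> ^ 2)))) * (1 + \<bar>\<theta>\<bar> / x) ^ t * (1 + 432 * v)"
        by (simp add: v_def)
      also have "\<dots> \<le> exp (- (v / 400)) * 2 ^ t * (1 + 432 * v)"
        using e p v x by (intro mult_right_mono mult_mono) auto
      also have "\<dots> \<le> exp (- (v / 400)) * 2 ^ t * (172800 * exp (v / 400))"
      proof (rule mult_left_mono)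
        show "1 + 432 * v \<le> 172800 * exp (v / 400)"
          using exp_ge_add_one_self[of "v / 400"] v by linarith
      qed simp
      also have "\<dots> = 2 ^ t * 172800" by (simp add: exp_minus field_simps)
      finally show ?thesis by (simp add: B_def)
    next
      case False
      \<comment> \<open>Here the exponent is at least y / 400, and |\<theta>| <= 4 bounds everything
        else by powers of y; 6913 = 432 * 16 + 1.\<close>
      define y where "y = 1 / x"
      have y: "y \<ge> 1" using x by (simp add: y_def)
      have sq: "x ^ 2 \<le> \<theta> ^ 2" using False x by (metis abs_ge_zero less_eq_real_def linorder_not_le power2_abs power_mono)
      have t0: "\<theta> ^ 2 > 0" using False x by auto
      have "y / 400 = \<theta> ^ 2 / (200 * x * (2 * \<theta> ^ 2))" using t0 by (simp add: y_def)
      also have "\<dots> \<le> \<theta> ^ 2 / (200 * x * (x ^ 2 + \<theta> ^ 2))"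
        using x pos sq t0 by (intro divide_left_mono mult_left_mono mult_pos_pos) auto
      finally have e: "exp (- (\<theta> ^ 2 / (200 * x * (x ^ 2 + \<theta> ^ 2)))) \<le> exp (- (y / 400))" by simp
      have \<theta>4: "\<bar>\<theta>\<bar> \<le> 4" using \<theta> pi_less_4 by linarith
      have "\<bar>\<theta>\<bar> / x \<le> 4 * y" using \<theta>4 x by (simp add: y_def field_simps)
      then have p: "(1 + \<bar>\<theta>\<bar> / x) ^ t \<le> (5 * y) ^ t"
        using y x by (intro power_mono) auto
      have "\<bar>\<theta>\<bar> ^ 2 \<le> 4 ^ 2" using \<theta>4 by (intro power_mono) auto
      then have "432 * \<theta> ^ 2 \<le> 6912" by simp
      then have "432 * \<theta> ^ 2 / x ^ 3 \<le> 6912 * y ^ 3" using x by (simp add: y_def divide_right_mono power_divide)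
      moreover have "1 \<le> y ^ 3" using y by (simp add: one_le_power)
      ultimately have q: "1 + 432 * \<theta> ^ 2 / x ^ 3 \<le> 6913 * y ^ 3" by linarith
      have "exp (- (\<theta> ^ 2 / (200 * x * (x ^ 2 + \<theta> ^ 2)))) * (1 + \<bar>\<theta>\<bar> / x) ^ t * (1 + 432 * \<theta> ^ 2 / x ^ 3)
         \<le> exp (- (y / 400)) * (5 * y) ^ t * (6913 * y ^ 3)"
        using e p q x y by (intro mult_mono) auto
      also have "\<dots> = 5 ^ t * 6913 * exp (- (y / 400)) * (400 ^ m * (y / 400) ^ m)"
        by (simp add: m_def power_mult_distrib power_add power_divide)
      also have "\<dots> \<le> 5 ^ t * 6913 * exp (- (y / 400)) * (400 ^ m * (real m ^ m * exp (y / 400)))"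
        using y by (intro mult_left_mono power_le_mult_exp) (auto simp: m_def)
      also have "\<dots> = 5 ^ t * 6913 * (400 ^ m * real m ^ m)" by (simp add: exp_minus field_simps)
      finally show ?thesis by (simp add: B_def)
    qed
  qed
qed

text \<open>Every factor is divided by its value at \<theta> = 0, so for x > 0 and positive s in S
  the integrand is 1 there, whatever S is.\<close>

definition saddle_integrand :: "nat \<Rightarrow> nat \<Rightarrow> nat set \<Rightarrow> real \<Rightarrow> real \<Rightarrow> complex" where
  "saddle_integrand K n S x \<theta> =
     euler_prod K (of_real (exp (-x)) * cis \<theta>) / euler_prod K (of_real (exp (-x))) * cis (- real n * \<theta>)
     * (\<Prod>s\<in>S. (1 - (of_real (exp (-x)) * cis \<theta>) ^ s) / (1 - of_real (exp (-x)) ^ s))"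

text \<open>The condition on \<open>K\<close> caps the truncation loss at 2, which after division by
  4 becomes the factor exp (1 / 2); likewise 200 = 4 * 50.\<close>

lemma norm_saddle_integrand_le:
  assumes x: "0 < x" "x \<le> 1" and \<theta>: "\<bar>\<theta>\<bar> \<le> pi" and S: "0 \<notin> S"
    and K: "exp (-x) ^ Suc K / (1 - exp (-x)) \<le> 1"
  shows "cmod (saddle_integrand K n S x \<theta>)
         \<le> exp (1 / 2) * (exp (- (\<theta> ^ 2 / (200 * x * (x ^ 2 + \<theta> ^ 2)))) * (1 + \<bar>\<theta>\<bar> / x) ^ card S)"
proof -
  let ?r = "of_real (exp (-x)) :: complex"
  have "cmod (euler_prod K (?r * cis \<theta>) / euler_prod K ?r)
      \<le> exp (- ((\<Sum>k=1..K. exp (-x) ^ k * (1 - cos (k * \<theta>))) / 4))"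
    using x by (intro norm_euler_prod_le)
  also have "\<dots> \<le> exp (1 / 2 - \<theta> ^ 2 / (50 * x * (x ^ 2 + \<theta> ^ 2)) / 4)"
  proof -
    have "2 * exp (-x) ^ Suc K / (1 - exp (-x)) \<le> 2" using K by (simp only: times_divide_eq_right[symmetric])
    moreover have "- (s / 4) \<le> 1 / 2 - v / 4" if "e \<le> 2" "v - e \<le> s" for e s v :: real
      using that by linarith
    ultimately show ?thesis
      unfolding exp_le_cancel_iff using sum_one_minus_cos_ge[OF x \<theta>, of K] by blast
  qed
  also have "\<dots> = exp (1 / 2) * exp (- (\<theta> ^ 2 / (200 * x * (x ^ 2 + \<theta> ^ 2))))"
    by (simp add: mult_exp_exp mult_ac)
  finally have 1: "cmod (euler_prod K (?r * cis \<theta>) / euler_prod K ?r) \<le> \<dots>" .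
  have "cmod (\<Prod>s\<in>S. (1 - (?r * cis \<theta>) ^ s) / (1 - ?r ^ s)) \<le> (\<Prod>s\<in>S. 1 + \<bar>\<theta>\<bar> / x)"
    unfolding prod_norm[symmetric]
  proof (intro prod_mono conjI norm_ge_zero)
    fix s assume "s \<in> S"
    then have "s > 0" using S by (cases s) auto
    from factor_ratio_bound[OF x(1) this, of \<theta>]
    show "cmod ((1 - (?r * cis \<theta>) ^ s) / (1 - ?r ^ s)) \<le> 1 + \<bar>\<theta>\<bar> / x"
      using norm_triangle_ineq2[of "(1 - (?r * cis \<theta>) ^ s) / (1 - ?r ^ s)" 1] by simp
  qed
  then have 2: "cmod (\<Prod>s\<in>S. (1 - (?r * cis \<theta>) ^ s) / (1 - ?r ^ s)) \<le> (1 + \<bar>\<theta>\<bar> / x) ^ card S"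
    by simp
  have "cmod (saddle_integrand K n S x \<theta>) = cmod (euler_prod K (?r * cis \<theta>) / euler_prod K ?r)
      * cmod (\<Prod>s\<in>S. (1 - (?r * cis \<theta>) ^ s) / (1 - ?r ^ s))"
    by (simp only: saddle_integrand_def norm_mult norm_cis mult_1_right)
  also have "\<dots> \<le> exp (1 / 2) * exp (- (\<theta> ^ 2 / (200 * x * (x ^ 2 + \<theta> ^ 2)))) * (1 + \<bar>\<theta>\<bar> / x) ^ card S"
    using 1 2 by (rule mult_mono) auto
  finally show ?thesis by (simp only: mult.assoc)
qed

lemma has_integral_saddle_integrand:
  fixes x :: real
  assumes "x > 0" "n \<le> K" "S \<subseteq> {1..K}"
  shows "(saddle_integrand K n S x has_integral
           of_real (2 * pi * exp (-x) ^ n * num_partitions_avoiding S n)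
             / (euler_prod K (of_real (exp (-x))) * of_real (\<Prod>s\<in>S. 1 - exp (-x) ^ s))) {-pi..pi}"
proof -
  let ?r = "of_real (exp (-x)) :: complex"
  let ?Q = "\<lambda>z A. \<Prod>a\<in>A. 1 - z ^ a :: complex"
  have ne: "1 - z ^ a \<noteq> 0" if "cmod z < 1" "a \<in> {1..K}" for z a
  proof
    assume "1 - z ^ a = 0"
    then have "cmod z ^ a = 1" by (metis eq_iff_diff_eq_0 norm_one norm_power)
    moreover have "cmod z ^ a < 1" using that by (simp add: power_less_one_iff)
    ultimately show False by simp
  qed
  \<comment> \<open>Forbidding the parts in S multiplies the full product by the polynomial of S;
    this needs S to lie below the truncation.\<close>
  have split: "1 / ?Q z ({1..K} - S) = euler_prod K z * ?Q z S" if "cmod z < 1" for z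
  proof -
    have "?Q z {1..K} = ?Q z ({1..K} - S) * ?Q z S"
      using assms(3) by (intro prod.subset_diff) auto
    moreover have "?Q z {1..K} \<noteq> 0" using ne[OF that] by simp
    moreover have "euler_prod K z = 1 / ?Q z {1..K}" by (simp add: euler_prod_def prod_dividef)
    ultimately show ?thesis by (auto simp: field_simps)
  qed
  have "((\<lambda>t. cis (- real n * t) / ?Q (?r * cis t) ({1..K} - S)) has_integral
      of_real (2 * pi * exp (-x) ^ n * num_partitions_avoiding S n)) {-pi..pi}"
    unfolding num_partitions_avoiding_eq_count[OF assms(2)] using assms
    by (intro has_integral_count_parts_in) auto
  then have "((\<lambda>t. cis (- real n * t) / ?Q (?r * cis t) ({1..K} - S) / (euler_prod K ?r * ?Q ?r S)) has_integral
      of_real (2 * pi * exp (-x) ^ n * num_partitions_avoiding S n) / (euler_prod K ?r * ?Q ?r S)) {-pi..pi}"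
    by (rule has_integral_divide)
  also have "(\<lambda>t. cis (- real n * t) / ?Q (?r * cis t) ({1..K} - S) / (euler_prod K ?r * ?Q ?r S)) = saddle_integrand K n S x"
  proof
    fix t
    have "cmod (?r * cis t) < 1" using assms by (simp add: norm_mult)
    from split[OF this] have "cis (- real n * t) / ?Q (?r * cis t) ({1..K} - S) = cis (- real n * t) * (euler_prod K (?r * cis t) * ?Q (?r * cis t) S)"
      by (metis mult_1_right times_divide_eq_right)
    then show "cis (- real n * t) / ?Q (?r * cis t) ({1..K} - S) / (euler_prod K ?r * ?Q ?r S) = saddle_integrand K n S x t"
      by (simp only: saddle_integrand_def prod_dividef) (simp add: mult_ac)
  qed
  also have "?Q ?r S = of_real (\<Prod>s\<in>S. 1 - exp (-x) ^ s)" by simp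
  finally show ?thesis .
qed

text \<open>The point is that neither the limit nor the normalising factor depends on S. Only its
  being nonzero matters later, so the Gaussian integral is not evaluated.\<close>

lemma saddle_limit:
  fixes x :: "nat \<Rightarrow> real" and K N :: "nat \<Rightarrow> nat" and I :: "nat \<Rightarrow> complex"
  assumes x: "\<And>i. 0 < x i" "\<And>i. x i \<le> 1" and x0: "x \<longlonglongrightarrow> 0"
    and K1: "\<And>i. 1 / x i \<le> K i"
    and K2: "\<And>i. exp (- x i) ^ Suc (K i) / (1 - exp (- x i)) \<le> 1"
    and K3: "\<And>i. \<bar>cum1 (K i) (x i) - N i\<bar> \<le> 5 / x i"
    and S: "finite S" "0 \<notin> S"
    and I: "\<And>i. (saddle_integrand (K i) (N i) S (x i) has_integral I i) {-pi..pi}"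
  shows "(\<lambda>i. of_real (sqrt (cum2 (K i) (x i))) * I i) \<longlonglongrightarrow> integral UNIV (\<lambda>u::real. of_real (exp (- (u ^ 2 / 2))))"
    and "integral UNIV (\<lambda>u::real. of_real (exp (- (u ^ 2 / 2))) :: complex) \<noteq> 0"
proof -
  define V where "V = (\<lambda>i. cum2 (K i) (x i))"
  define \<sigma> where "\<sigma> = (\<lambda>i. 1 / sqrt (V i))"
  define F where "F = (\<lambda>i. saddle_integrand (K i) (N i) S (x i))"
  \<comment> \<open>Extension by zero puts all the rescaled integrands on the whole line, as
    dominated convergence requires.\<close>
  define f where "f = (\<lambda>i u. if \<bar>\<sigma> i * u\<bar> \<le> pi then F i (\<sigma> i * u) else 0)"
  define g where "g = (\<lambda>u::real. of_real (exp (- (u ^ 2 / 2))) :: complex)"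
  have V: "V i \<le> 432 / x i ^ 3" "V i \<ge> 1 / (6 * x i ^ 3)" for i
    using x K1 by (auto simp: V_def intro!: cum2_le cum2_ge)
  have Vpos: "V i > 0" for i using V(2)[of i] x(1)[of i] by (smt (verit) zero_less_divide_1_iff zero_less_power zero_less_mult_iff)
  have \<sigma>pos: "\<sigma> i > 0" for i using Vpos by (simp add: \<sigma>_def)
  have \<sigma>V: "(\<sigma> i * u) ^ 2 * V i = u ^ 2" for i u
    using Vpos[of i] by (simp add: \<sigma>_def power_mult_distrib power_divide)
  \<comment> \<open>The lower bound on the variance gives the scale \<sigma> = O(x^(3/2)).\<close>
  have \<sigma>le: "\<sigma> i \<le> x i * sqrt (6 * x i)" for i
  proof -
    have "(1 / (x i * sqrt (6 * x i))) ^ 2 = 1 / (6 * x i ^ 3)"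
      using x(1)[of i] by (simp add: power_divide power_mult_distrib eval_nat_numeral)
    also have "\<dots> \<le> V i" by (rule V)
    finally have "1 / (x i * sqrt (6 * x i)) \<le> sqrt (V i)" by (rule real_le_rsqrt)
    then show ?thesis using x(1)[of i] Vpos[of i] by (simp add: \<sigma>_def field_simps)
  qed
  have f: "(f i has_integral of_real (sqrt (V i)) * I i) UNIV" for i
  proof -
    have "((\<lambda>u. F i (\<sigma> i * u)) has_integral (1 / \<bar>\<sigma> i\<bar>) *\<^sub>R I i) ((\<lambda>u. u / \<sigma> i) ` {-pi..pi})"
      unfolding F_def using I \<sigma>pos[of i] by (intro has_integral_stretch_real) auto
    moreover have "(\<lambda>u. u / \<sigma> i) ` {-pi..pi} = {u. \<bar>\<sigma> i * u\<bar> \<le> pi}"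
    proof safe
      fix u assume "\<bar>\<sigma> i * u\<bar> \<le> pi"
      then show "u \<in> (\<lambda>u. u / \<sigma> i) ` {-pi..pi}"
        using \<sigma>pos[of i] by (intro image_eqI[of _ _ "\<sigma> i * u"]) auto
    qed (use \<sigma>pos[of i] in auto)
    moreover have "1 / \<bar>\<sigma> i\<bar> = sqrt (V i)" using Vpos[of i] by (simp add: \<sigma>_def)
    ultimately have "((\<lambda>u. F i (\<sigma> i * u)) has_integral of_real (sqrt (V i)) * I i) {u. \<bar>\<sigma> i * u\<bar> \<le> pi}"
      by (simp add: scaleR_conv_of_real)
    then show ?thesis unfolding f_def by (subst (asm) has_integral_restrict_UNIV[symmetric]) simp
  qed
  obtain B where B: "\<And>x \<theta>. 0 < x \<Longrightarrow> x \<le> 1 \<Longrightarrow> \<bar>\<theta>\<bar> \<le> pi \<Longrightarrow>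
     exp (- (\<theta> ^ 2 / (200 * x * (x ^ 2 + \<theta> ^ 2)))) * (1 + \<bar>\<theta>\<bar> / x) ^ card S * (1 + 432 * \<theta> ^ 2 / x ^ 3) \<le> B"
    using tail_domination[of "card S"] by blast
  have B0: "B \<ge> 0" using B[of 1 0] by simp
  define h where "h = (\<lambda>u::real. exp (1 / 2) * B * (1 / (1 + u ^ 2)))"
  have h: "h integrable_on UNIV"
    unfolding h_def using integrable_inverse_one_plus_square by (rule integrable_on_mult_right)
  have le: "norm (f i u) \<le> h u" for i u
  proof (cases "\<bar>\<sigma> i * u\<bar> \<le> pi")
    case True
    define \<theta> where "\<theta> = \<sigma> i * u"
    define E where "E = exp (- (\<theta> ^ 2 / (200 * x i * (x i ^ 2 + \<theta> ^ 2)))) * (1 + \<bar>\<theta>\<bar> / x i) ^ card S"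
    have E0: "E \<ge> 0" using x(1)[of i] by (simp add: E_def)
    have "u ^ 2 = \<theta> ^ 2 * V i" by (simp add: \<theta>_def \<sigma>V)
    also have "\<dots> \<le> \<theta> ^ 2 * (432 / x i ^ 3)" using V by (intro mult_left_mono) auto
    finally have "E * (1 + u ^ 2) \<le> E * (1 + 432 * \<theta> ^ 2 / x i ^ 3)"
      using E0 by (intro mult_left_mono) (auto simp: mult_ac)
    also have "\<dots> \<le> B" using B[OF x, of \<theta> i] True by (simp add: E_def \<theta>_def)
    finally have "E \<le> B * (1 / (1 + u ^ 2))" by (simp add: pos_le_divide_eq add_pos_nonneg)
    moreover have "norm (f i u) \<le> exp (1 / 2) * E"
      unfolding E_def f_def F_def \<theta>_def using True x S K2
      by (simp del: power_Suc) (intro norm_saddle_integrand_le, auto)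
    ultimately show ?thesis unfolding h_def mult.assoc
      by (meson exp_ge_zero mult_left_mono order_trans)
  next
    case False
    then show ?thesis using B0 by (simp add: f_def h_def)
  qed
  have conv: "(\<lambda>i. f i u) \<longlonglongrightarrow> g u" for u
  proof -
    define \<theta> where "\<theta> = (\<lambda>i. \<sigma> i * u)"
    \<comment> \<open>A null sequence that bounds |\<theta>| / x, and hence also |\<theta>| since x
      <= 1.\<close>
    define \<eta> where "\<eta> = (\<lambda>i. sqrt (6 * x i) * \<bar>u\<bar>)"
    have sq0: "(\<lambda>i. sqrt (6 * x i)) \<longlonglongrightarrow> 0"
      using tendsto_real_sqrt[OF tendsto_mult_left[OF x0, of 6]] by simp
    have \<eta>0: "\<eta> \<longlonglongrightarrow> 0"
      unfolding \<eta>_def using tendsto_mult_right[OF sq0, of "\<bar>u\<bar>"] by simp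
    have \<theta>\<eta>: "\<bar>\<theta> i\<bar> / x i \<le> \<eta> i" for i
    proof -
      have "\<bar>\<theta> i\<bar> \<le> x i * sqrt (6 * x i) * \<bar>u\<bar>"
        unfolding \<theta>_def abs_mult using \<sigma>pos[of i] \<sigma>le[of i] by (intro mult_right_mono) auto
      then show ?thesis using x(1)[of i] by (simp add: \<eta>_def field_simps)
    qed
    have \<theta>le: "\<bar>\<theta> i\<bar> \<le> \<eta> i" for i
    proof -
      have "\<bar>\<theta> i\<bar> \<le> \<bar>\<theta> i\<bar> / x i" using x[of i] by (simp add: field_simps mult_left_le_one_le)
      then show ?thesis using \<theta>\<eta>[of i] by linarith
    qed
    have in_range: "\<forall>\<^sub>F i in sequentially. \<bar>\<theta> i\<bar> \<le> pi"
    proof (rule eventually_mono[OF order_tendstoD(2)[OF \<eta>0 pi_gt_zero]])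
      fix i assume "\<eta> i < pi"
      then show "\<bar>\<theta> i\<bar> \<le> pi" using \<theta>le[of i] by linarith
    qed
    have "\<forall>i. \<exists>\<epsilon>. cmod \<epsilon> \<le> 432 * \<bar>\<theta> i\<bar> ^ 3 / x i ^ 4 \<and>
      euler_prod (K i) (of_real (exp (- x i)) * cis (\<theta> i)) / euler_prod (K i) (of_real (exp (- x i)))
         = exp (\<i> * \<theta> i * cum1 (K i) (x i) - (\<theta> i) ^ 2 / 2 * cum2 (K i) (x i) + \<epsilon>)"
      using euler_prod_Taylor[OF x(1)] by metis
    then obtain \<epsilon> where \<epsilon>: "\<And>i. cmod (\<epsilon> i) \<le> 432 * \<bar>\<theta> i\<bar> ^ 3 / x i ^ 4"
      and eq: "\<And>i. euler_prod (K i) (of_real (exp (- x i)) * cis (\<theta> i)) / euler_prod (K i) (of_real (exp (- x i)))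
         = exp (\<i> * \<theta> i * cum1 (K i) (x i) - (\<theta> i) ^ 2 / 2 * cum2 (K i) (x i) + \<epsilon> i)" by metis
    \<comment> \<open>The non-Gaussian part of the exponent: the phase left by the inexact saddle
      point plus the Taylor error.\<close>
    define w where "w = (\<lambda>i. \<i> * of_real (\<theta> i * (cum1 (K i) (x i) - N i)) + \<epsilon> i)"
    have w0: "w \<longlonglongrightarrow> 0"
    proof (rule Lim_null_comparison)
      show "\<forall>\<^sub>F i in sequentially. norm (w i) \<le> 5 * \<eta> i + 2592 * sqrt (6 * x i) * \<bar>u\<bar> ^ 3"
      proof (intro always_eventually allI)
        fix i
        have "\<bar>\<theta> i * (cum1 (K i) (x i) - N i)\<bar> \<le> \<bar>\<theta> i\<bar> * (5 / x i)"
          unfolding abs_mult using K3 by (intro mult_left_mono) auto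
        also have "\<dots> = 5 * (\<bar>\<theta> i\<bar> / x i)" by simp
        also have "\<dots> \<le> 5 * \<eta> i" using \<theta>\<eta>[of i] by (rule mult_left_mono) simp
        finally have 1: "\<bar>\<theta> i * (cum1 (K i) (x i) - N i)\<bar> \<le> 5 * \<eta> i" .
        \<comment> \<open>The cube of \<eta> has order x^(3/2), so after division by x a factor sqrt
          x survives; 2592 = 432 * 6.\<close>
        have "\<bar>\<theta> i\<bar> ^ 3 / x i ^ 4 = (\<bar>\<theta> i\<bar> / x i) ^ 3 / x i"
          by (simp add: power_divide eval_nat_numeral)
        also have "\<dots> \<le> \<eta> i ^ 3 / x i"
          using \<theta>\<eta>[of i] x(1)[of i] by (intro divide_right_mono power_mono) auto
        also have "\<eta> i ^ 3 = 6 * x i * sqrt (6 * x i) * \<bar>u\<bar> ^ 3"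
        proof -
          have "sqrt (6 * x i) ^ 3 = 6 * x i * sqrt (6 * x i)"
            using x(1)[of i] by (simp add: power3_eq_cube)
          then show ?thesis by (simp only: \<eta>_def power_mult_distrib)
        qed
        also have "6 * x i * sqrt (6 * x i) * \<bar>u\<bar> ^ 3 / x i = 6 * (sqrt (6 * x i) * \<bar>u\<bar> ^ 3)"
          using x(1)[of i] by simp
        finally have "432 * \<bar>\<theta> i\<bar> ^ 3 / x i ^ 4 \<le> 2592 * sqrt (6 * x i) * \<bar>u\<bar> ^ 3"
          by simp
        then have 2: "cmod (\<epsilon> i) \<le> 2592 * sqrt (6 * x i) * \<bar>u\<bar> ^ 3" using \<epsilon>[of i] by linarith
        have "norm (w i) \<le> cmod (\<i> * of_real (\<theta> i * (cum1 (K i) (x i) - N i))) + cmod (\<epsilon> i)"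
          unfolding w_def by (rule norm_triangle_ineq)
        also have "cmod (\<i> * of_real (\<theta> i * (cum1 (K i) (x i) - N i))) = \<bar>\<theta> i * (cum1 (K i) (x i) - N i)\<bar>"
          by (simp only: norm_mult norm_ii norm_of_real mult_1_left)
        finally show "norm (w i) \<le> 5 * \<eta> i + 2592 * sqrt (6 * x i) * \<bar>u\<bar> ^ 3" using 1 2 by linarith
      qed
      have "(\<lambda>i. 5 * \<eta> i + 2592 * sqrt (6 * x i) * \<bar>u\<bar> ^ 3) \<longlonglongrightarrow> 5 * 0 + 2592 * 0 * \<bar>u\<bar> ^ 3"
        by (intro tendsto_intros \<eta>0 sq0)
      then show "(\<lambda>i. 5 * \<eta> i + 2592 * sqrt (6 * x i) * \<bar>u\<bar> ^ 3) \<longlonglongrightarrow> 0" by simp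
    qed
    define R where "R = (\<lambda>i. \<Prod>s\<in>S. (1 - (of_real (exp (- x i)) * cis (\<theta> i)) ^ s) / (1 - of_real (exp (- x i)) ^ s) :: complex)"
    have "R \<longlonglongrightarrow> (\<Prod>s\<in>S. 1)"
      unfolding R_def
    proof (rule tendsto_prod)
      fix s assume "s \<in> S"
      then have "s > 0" using S by (cases s) auto
      have "(\<lambda>i. (1 - (of_real (exp (- x i)) * cis (\<theta> i)) ^ s) / (1 - of_real (exp (- x i)) ^ s) - 1 :: complex) \<longlonglongrightarrow> 0"
        by (rule Lim_null_comparison[OF _ \<eta>0])
           (intro always_eventually allI order_trans[OF factor_ratio_bound[OF x(1) \<open>s > 0\<close>] \<theta>\<eta>])
      then show "(\<lambda>i. (1 - (of_real (exp (- x i)) * cis (\<theta> i)) ^ s) / (1 - of_real (exp (- x i)) ^ s) :: complex) \<longlonglongrightarrow> 1"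
        by (rule LIM_zero_cancel)
    qed
    then have R1: "R \<longlonglongrightarrow> 1" by simp
    have "(\<lambda>i. exp (of_real (- (u ^ 2 / 2)) + w i) * R i) \<longlonglongrightarrow> exp (of_real (- (u ^ 2 / 2)) + 0) * 1"
      by (intro tendsto_mult tendsto_exp tendsto_add tendsto_const w0 R1)
    also have "exp (of_real (- (u ^ 2 / 2)) + 0) * 1 = g u" by (simp only: g_def exp_of_real add_0_right mult_1_right)
    also have "(\<lambda>i. exp (of_real (- (u ^ 2 / 2)) + w i) * R i) = (\<lambda>i. F i (\<theta> i))"
    proof
      fix i
      have V2: "(\<theta> i) ^ 2 / 2 * cum2 (K i) (x i) = u ^ 2 / 2"
        using \<sigma>V[of i u] by (simp add: \<theta>_def V_def)
      have "of_real ((\<theta> i) ^ 2 / 2 * cum2 (K i) (x i)) = (of_real (u ^ 2 / 2) :: complex)"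
        by (simp only: V2)
      then have "\<i> * \<theta> i * cum1 (K i) (x i) - (\<theta> i) ^ 2 / 2 * cum2 (K i) (x i) + \<epsilon> i + \<i> * of_real (- real (N i) * \<theta> i)
         = of_real (- (u ^ 2 / 2)) + w i"
        by (simp add: w_def algebra_simps)
      then show "exp (of_real (- (u ^ 2 / 2)) + w i) * R i = F i (\<theta> i)"
        unfolding F_def saddle_integrand_def eq cis_conv_exp[of "- real (N i) * \<theta> i"] R_def
        by (simp only: exp_add[symmetric])
    qed
    finally have "(\<lambda>i. F i (\<theta> i)) \<longlonglongrightarrow> g u" .
    moreover have "\<forall>\<^sub>F i in sequentially. F i (\<theta> i) = f i u"
      using in_range by eventually_elim (simp add: f_def \<theta>_def)
    ultimately show ?thesis by (rule Lim_transform_eventually)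
  qed
  note dc = dominated_convergence[of f UNIV h g, OF has_integral_integrable[OF f] h le conv]
  show "(\<lambda>i. of_real (sqrt (cum2 (K i) (x i))) * I i) \<longlonglongrightarrow> integral UNIV (\<lambda>u::real. of_real (exp (- (u ^ 2 / 2))))"
    using dc(2) unfolding integral_unique[OF f] by (simp add: V_def g_def)
  have "g integrable_on UNIV" by (rule dc(1))
  then have Re: "((\<lambda>u. Re (g u)) has_integral Re (integral UNIV g)) UNIV"
    by (intro has_integral_Re integrable_integral)
  have "(\<lambda>u. Re (g u)) = (\<lambda>u. exp (- (u ^ 2 / 2)))" by (simp only: g_def Re_complex_of_real)
  with Re have G: "((\<lambda>u. exp (- (u ^ 2 / 2))) has_integral Re (integral UNIV g)) UNIV" by simp
  \<comment> \<open>The integral over {0..1} alone is at least exp (- 1 / 2).\<close>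
  have "0 < exp (- (1 / 2)) * (1 - 0 :: real)" by simp
  also have "\<dots> \<le> integral {0..1} (\<lambda>u::real. exp (- (u ^ 2 / 2)))"
  proof (rule has_integral_le)
    show "((\<lambda>u::real. exp (- (1 / 2)) :: real) has_integral exp (- (1 / 2)) * (1 - 0)) {0..1}"
      using has_integral_const_real[of "exp (- (1 / 2)) :: real" 0 1] by simp
    show "((\<lambda>u::real. exp (- (u ^ 2 / 2))) has_integral integral {0..1} (\<lambda>u::real. exp (- (u ^ 2 / 2)))) {0..1}"
      by (intro integrable_integral integrable_continuous_interval continuous_intros) auto
  qed (auto simp: power_le_one)
  also have "\<dots> \<le> integral UNIV (\<lambda>u::real. exp (- (u ^ 2 / 2)))"
    using G by (intro integral_subset_le integrable_continuous_interval continuous_intros) auto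
  also have "\<dots> = Re (integral UNIV g)" using G by (rule integral_unique)
  finally have "Re (integral UNIV g) \<noteq> 0" by simp
  then show "integral UNIV (\<lambda>u::real. of_real (exp (- (u ^ 2 / 2))) :: complex) \<noteq> 0"
    unfolding g_def by auto
qed

section \<open>Choice of the parameters, and the quotient of the two counts\<close>

lemma saddle_scale_bounds:
  fixes n :: nat
  assumes "n \<ge> 3"
  shows "0 < C / (2 * sqrt n)" "C / (2 * sqrt n) \<le> 1" "pi ^ 2 / (6 * (C / (2 * sqrt n)) ^ 2) = n"
proof -
  have C2: "C ^ 2 = pi ^ 2 * 2 / 3" by (simp add: C_def power_mult_distrib)
  show "0 < C / (2 * sqrt n)" using assms by (simp add: C_def)
  have "pi ^ 2 \<le> 4 ^ 2" using pi_less_4 by (intro power_mono) auto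
  \<comment> \<open>The threshold 3 enters here: C^2 = 2 pi^2 / 3 <= 32 / 3 <= 4 n.\<close>
  then have "C ^ 2 \<le> (2 * sqrt n) ^ 2" using assms unfolding C2 by (simp add: power_mult_distrib)
  then have "C \<le> 2 * sqrt n" by (rule power2_le_imp_le) simp
  then show "C / (2 * sqrt n) \<le> 1" using assms by simp
  show "pi ^ 2 / (6 * (C / (2 * sqrt n)) ^ 2) = n"
    unfolding power_divide C2 using assms by (simp add: power_mult_distrib field_simps)
qed

text \<open>For fixed x each condition holds for all large K, hence all hold together for some
  K.\<close>

lemma exists_truncation:
  fixes x :: real
  assumes x: "0 < x" "x \<le> 1" and S: "finite S" "0 \<notin> S"
  shows "\<exists>K\<ge>n. S \<subseteq> {1..K} \<and> 1 / x \<le> K \<and> exp (-x) ^ Suc K / (1 - exp (-x)) \<le> 1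
    \<and> \<bar>cum1 K x - pi ^ 2 / (6 * x ^ 2)\<bar> \<le> 5 / x"
proof -
  have e: "exp (-x) < 1" using x by simp
  then have "(\<lambda>K. exp (-x) ^ K) \<longlonglongrightarrow> 0" by (intro LIMSEQ_power_zero) simp
  then have "(\<lambda>K. exp (-x) ^ Suc K / (1 - exp (-x))) \<longlonglongrightarrow> 0 / (1 - exp (-x))"
    by (rule tendsto_divide[OF LIMSEQ_Suc tendsto_const]) (use e in simp)
  then have 1: "\<forall>\<^sub>F K in sequentially. exp (-x) ^ Suc K / (1 - exp (-x)) < 1"
    by (rule order_tendstoD) simp
  have 2: "\<forall>\<^sub>F K in sequentially. 1 / x \<le> real K" by real_asymp
  have 3: "\<forall>\<^sub>F K in sequentially. K \<ge> Max (insert n S)" by (rule eventually_ge_at_top)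
  have "\<forall>\<^sub>F K in sequentially. K \<ge> n \<and> S \<subseteq> {1..K} \<and> 1 / x \<le> K \<and> exp (-x) ^ Suc K / (1 - exp (-x)) \<le> 1
    \<and> \<bar>cum1 K x - pi ^ 2 / (6 * x ^ 2)\<bar> \<le> 5 / x"
    using 1 2 3 eventually_cum1_approx[OF x(1)]
  proof eventually_elim
    case (elim K)
    \<comment> \<open>Since x <= 1 and pi < 4, the error pi / x + 1 fits under 5 / x.\<close>
    have "(pi + x) / x \<le> 5 / x" using x pi_less_4 by (intro divide_right_mono) auto
    then have "pi / x + 1 \<le> 5 / x" using x by (simp add: add_divide_distrib)
    then have "\<bar>cum1 K x - pi ^ 2 / (6 * x ^ 2)\<bar> \<le> 5 / x" using elim(4) by (rule order_trans[rotated])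
    moreover have "n \<le> K" using elim(3) S by simp
    moreover have "S \<subseteq> {1..K}"
    proof
      fix s assume "s \<in> S"
      moreover from this have "s \<noteq> 0" using S by metis
      ultimately show "s \<in> {1..K}" using elim(3) S by auto
    qed
    ultimately show ?case using elim(2) less_imp_le[OF elim(1)] by (intro conjI)
  qed
  then show ?thesis using eventually_happens'[OF sequentially_bot] by blast
qed

lemma num_partitions_eq_avoiding_empty: "num_partitions n = num_partitions_avoiding {} n"
  by (simp add: num_partitions_def num_partitions_avoiding_def)

lemma partition_ratio_limit:
  assumes S: "finite S" "0 \<notin> S"
  defines "x \<equiv> \<lambda>n. C / (2 * sqrt (real n))"
  shows "(\<lambda>n. real (num_partitions_avoiding S n) / (real (num_partitions n) * (\<Prod>s\<in>S. 1 - exp (- x n) ^ s))) \<longlonglongrightarrow> 1"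
proof (rule LIMSEQ_offset)
  \<comment> \<open>The shift by 3 makes \<open>saddle_scale_bounds\<close> available at every
    index.\<close>
  define y where "y = (\<lambda>i. x (i + 3))"
  have y: "0 < y i" "y i \<le> 1" "pi ^ 2 / (6 * y i ^ 2) = real (i + 3)" for i
    using saddle_scale_bounds[of "i + 3"] by (auto simp: y_def x_def)
  have y0: "y \<longlonglongrightarrow> 0"
    unfolding y_def x_def by real_asymp
  have "\<forall>i. \<exists>K\<ge>i + 3. S \<subseteq> {1..K} \<and> 1 / y i \<le> K \<and> exp (- y i) ^ Suc K / (1 - exp (- y i)) \<le> 1
    \<and> \<bar>cum1 K (y i) - real (i + 3)\<bar> \<le> 5 / y i"
    using exists_truncation[OF y(1,2) S] unfolding y(3) by blast
  then obtain K where K: "\<And>i. i + 3 \<le> K i" "\<And>i. S \<subseteq> {1..K i}" "\<And>i. 1 / y i \<le> K i"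
    "\<And>i. exp (- y i) ^ Suc (K i) / (1 - exp (- y i)) \<le> 1" "\<And>i. \<bar>cum1 (K i) (y i) - real (i + 3)\<bar> \<le> 5 / y i"
    by metis
  define Q where "Q = (\<lambda>i. \<Prod>s\<in>S. 1 - exp (- y i) ^ s)"
  define G where "G = (\<lambda>i. euler_prod (K i) (of_real (exp (- y i))))"
  \<comment> \<open>The normalisation common to both counts. It is never estimated, only shown
    nonzero so that it cancels in the quotient.\<close>
  define c where "c = (\<lambda>i. of_real (sqrt (cum2 (K i) (y i))) * of_real (2 * pi * exp (- y i) ^ (i + 3)) / G i)"
  define L where "L = integral UNIV (\<lambda>u::real. of_real (exp (- (u ^ 2 / 2))) :: complex)"
  \<comment> \<open>The same K works for every subset T of S; T = S and T = {} give numerator and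
    denominator.\<close>
  have lim: "(\<lambda>i. c i * of_real (num_partitions_avoiding T (i + 3) / (\<Prod>s\<in>T. 1 - exp (- y i) ^ s))) \<longlonglongrightarrow> L"
    and L: "L \<noteq> 0" if "T \<subseteq> S" for T
  proof -
    have T: "finite T" "0 \<notin> T" "T \<subseteq> {1..K i}" for i using that S K(2)[of i] finite_subset by auto
    note sl = saddle_limit[OF y(1,2) y0 K(3-5) T(1,2) has_integral_saddle_integrand[OF y(1) K(1) T(3)]]
    show "L \<noteq> 0" unfolding L_def by (rule sl(2))
    show "(\<lambda>i. c i * of_real (num_partitions_avoiding T (i + 3) / (\<Prod>s\<in>T. 1 - exp (- y i) ^ s))) \<longlonglongrightarrow> L"
      using sl(1) by (simp add: L_def c_def G_def mult_ac)
  qed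
  have c0: "c i \<noteq> 0" for i
  proof -
    have "cum2 (K i) (y i) \<ge> 1 / (6 * y i ^ 3)" using y K(3) by (intro cum2_ge)
    moreover have "1 / (6 * y i ^ 3) > 0" using y(1)[of i] by simp
    ultimately have "cum2 (K i) (y i) > 0" by linarith
    moreover have "1 - of_real (exp (- y i)) ^ k \<noteq> (0 :: complex)" if "k \<in> {1..K i}" for k
    proof -
      have "exp (- y i) ^ k < 1" using that y(1)[of i] by (simp add: power_less_one_iff)
      then have "exp (- y i) ^ k \<noteq> 1" by simp
      then show ?thesis by (metis eq_iff_diff_eq_0 of_real_eq_1_iff of_real_power)
    qed
    then have "G i \<noteq> 0" by (auto simp: G_def euler_prod_def)
    ultimately show ?thesis by (simp add: c_def)
  qed
  have "(\<lambda>i. (c i * of_real (num_partitions_avoiding S (i + 3) / Q i)) / (c i * of_real (num_partitions (i + 3)))) \<longlonglongrightarrow> L / L"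
    using lim[of S] lim[of "{}"] L[of S] unfolding Q_def num_partitions_eq_avoiding_empty
    by (intro tendsto_divide) auto
  also have "(\<lambda>i. (c i * of_real (num_partitions_avoiding S (i + 3) / Q i)) / (c i * of_real (num_partitions (i + 3))))
     = (\<lambda>i. of_real (num_partitions_avoiding S (i + 3) / (num_partitions (i + 3) * Q i)))"
    using c0 by (intro ext) (simp add: mult_ac)
  also have "L / L = of_real 1" using L[of S] by simp
  finally have "(\<lambda>i. real (num_partitions_avoiding S (i + 3)) / (num_partitions (i + 3) * Q i)) \<longlonglongrightarrow> 1"
    by (simp only: tendsto_of_real_iff)
  then show "(\<lambda>n. real (num_partitions_avoiding S (n + 3)) / (real (num_partitions (n + 3)) * (\<Prod>s\<in>S. 1 - exp (- x (n + 3)) ^ s))) \<longlonglongrightarrow> 1"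
    by (simp only: Q_def y_def)
qed

theorem theorem2:
  fixes S :: "nat set" and t :: nat
  assumes "finite S"
    and "\<forall>s\<in>S. 0 < s"
    and "card S = t"
  shows "(\<lambda>n. real (num_partitions_avoiding S n)) \<sim>[sequentially]
           (\<lambda>n. real (num_partitions n) * (C / (2 * sqrt (real n))) ^ t * (\<Prod>s\<in>S. real s))
       \<and> (\<forall>n\<ge>1. real (num_partitions n) * (C / (2 * sqrt (real n))) ^ t * (\<Prod>s\<in>S. real s)
             = real (num_partitions n) * (\<Prod>s\<in>S. C * real s / (2 * sqrt (real n))))"
proof
  define x where "x = (\<lambda>n. C / (2 * sqrt (real n)))"
  have S: "0 \<notin> S" using assms(2) by auto
  have C: "C > 0" by (simp add: C_def)
  have prod: "x n ^ t * (\<Prod>s\<in>S. real s) = (\<Prod>s\<in>S. C * real s / (2 * sqrt (real n)))" for n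
    by (simp add: x_def prod.distrib[symmetric] assms(3)[symmetric] prod_constant[symmetric] del: prod_constant)
  then show "\<forall>n\<ge>1. real (num_partitions n) * (C / (2 * sqrt (real n))) ^ t * (\<Prod>s\<in>S. real s)
             = real (num_partitions n) * (\<Prod>s\<in>S. C * real s / (2 * sqrt (real n)))"
    by (simp add: x_def mult.assoc)
  have x0: "filterlim x (at_right 0) sequentially"
    unfolding x_def using C by real_asymp
  \<comment> \<open>Factor by factor, this is (1 - exp (- u)) / u -> 1 at u = s x.\<close>
  have "(\<lambda>n. \<Prod>s\<in>S. (1 - exp (- x n) ^ s) / (C * real s / (2 * sqrt (real n)))) \<longlonglongrightarrow> (\<Prod>s\<in>S. 1)"
  proof (rule tendsto_prod)
    fix s assume "s \<in> S"
    then have s: "real s > 0" using assms(2) by auto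
    then have "((\<lambda>x. (1 - exp (- (real s * x))) / (real s * x)) \<longlongrightarrow> 1) (at_right 0)"
      by real_asymp
    from filterlim_compose[OF this x0]
    show "(\<lambda>n. (1 - exp (- x n) ^ s) / (C * real s / (2 * sqrt (real n)))) \<longlonglongrightarrow> 1"
      by (simp add: x_def exp_of_nat_mult[symmetric] mult_ac)
  qed
  from tendsto_mult[OF partition_ratio_limit[OF assms(1) S] this[unfolded x_def]]
  have lim: "(\<lambda>n. real (num_partitions_avoiding S n) / (real (num_partitions n) * (\<Prod>s\<in>S. 1 - exp (- x n) ^ s))
     * (\<Prod>s\<in>S. (1 - exp (- x n) ^ s) / (C * real s / (2 * sqrt (real n))))) \<longlonglongrightarrow> 1"
    by (simp add: x_def)
  show "(\<lambda>n. real (num_partitions_avoiding S n)) \<sim>[sequentially]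
           (\<lambda>n. real (num_partitions n) * (C / (2 * sqrt (real n))) ^ t * (\<Prod>s\<in>S. real s))"
  \<comment> \<open>The index 0 is excluded because \<open>x 0\<close> is 0 by division by zero, and
    then the factors to be cancelled vanish.\<close>
  proof (rule asymp_equivI', rule Lim_transform_eventually[OF lim], rule eventually_mono[OF eventually_ge_at_top[of 1]])
    fix n :: nat assume "n \<ge> 1"
    then have "x n > 0" using C by (simp add: x_def)
    then have "1 - exp (- x n) ^ s \<noteq> 0" if "s \<in> S" for s
      using that assms(2) power_less_one_iff[of "exp (- x n)" s] by auto
    then have "(\<Prod>s\<in>S. 1 - exp (- x n) ^ s) \<noteq> 0" using assms(1) by simp
    then have "real (num_partitions_avoiding S n) / (real (num_partitions n) * (\<Prod>s\<in>S. 1 - exp (- x n) ^ s))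
     * (\<Prod>s\<in>S. (1 - exp (- x n) ^ s) / (C * real s / (2 * sqrt (real n))))
       = real (num_partitions_avoiding S n) / (real (num_partitions n) * (x n ^ t * (\<Prod>s\<in>S. real s)))"
      unfolding prod prod_dividef by simp
    then show "real (num_partitions_avoiding S n) / (real (num_partitions n) * (\<Prod>s\<in>S. 1 - exp (- x n) ^ s))
     * (\<Prod>s\<in>S. (1 - exp (- x n) ^ s) / (C * real s / (2 * sqrt (real n))))
       = real (num_partitions_avoiding S n) / (real (num_partitions n) * (C / (2 * sqrt (real n))) ^ t * (\<Prod>s\<in>S. real s))"
      by (simp add: x_def mult.assoc)
  qed
qed

end
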